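(* Let $1\le p<\infty$ and let $M,N$ be complete $\tau$-structures with $M\equiv^p N$ (i.e. $\sigma^M=\sigma^N$ for every $\mathscr L^p$-sentence $\sigma$ of $\tau$). Then there is a charge space $(I,\mathscr A,\mu)$ such that $M$ and $N$ are $\mathscr A$-meanable and $M^{\mu}\simeq N^{\mu}$ (isomorphic as $\tau$-structures), where $M^\mu,N^\mu$ denote the $p$-powermeans.
   Context: Fix $1\le p<\infty$. Logic. A modulus is an increasing continuous concave function $\lambda:[0,\infty)\to[0,\infty)$ with $\lambda(0)=0$; a map $f$ between metric spaces is $\lambda$-continuous if $d(f(x),f(y))\le\lambda(d(x,y))$ for all $x,y$. A signature $\tau$ is a set of function, relation and constant symbols; each function symbol $F$ has a modulus $\lambda_F$, each relation symbol $R$ has a modulus $\lambda_R$ and a bound $\mathbf b_R\ge0$; $\tau$ contains a distinguished binary relation symbol $d$ with $\mathbf b_d=1$. A $\tau$-structure is a (not necessarily complete) metric space $(M,d)$ with $d$ interpreted as the metric (so diameter $\le1$), each $F^M:M^n\to M$ being $\lambda_F$-continuous, each (non-metric) $R^M:M^n\to\mathbb R$ being $\lambda_R$-continuous with $|R^M|\le\mathbf b_R$, where $M^n$ carries the metric $d_n(\bar x,\bar y)=(\sum_{k=1}^n d(x_k,y_k)^p)^{1/p}$. $M$ is complete if it is a complete metric space. $\mathscr L^p$-formulas are built inductively from $r$ ($r\in\mathbb R$), $d(t_1,t_2)^p$, $R(t_1,\dots,t_n)$ ($R\neq d$, $t_i$ terms) by $r\phi$, $\phi+\psi$, $\sup_x\phi$,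 $\inf_x\phi$, and evaluated in $M$ in the obvious way. Sentences are formulas without free variables. An isomorphism is a bijection preserving the metric and all symbols of $\tau$. Charges. A charge space $(I,\mathscr A,\mu)$ consists of a set $I$, a Boolean algebra $\mathscr A$ of subsets of $I$ and a finitely additive $\mu:\mathscr A\to[0,\infty)$ with $\mu(I)=1$. Integrals of bounded functions $f:I\to\mathbb R$ with $f^{-1}([u,v))\in\mathscr A$ for all $u<v$ are defined as usual (uniform limits of simple functions). $p$-powermean. $M$ is $\mathscr A$-meanable if for some cardinal $\kappa$ the metric space $M$ has a dense subset of cardinality $\le\kappa$ and $\mathscr A$ is $\kappa^+$-complete (closed under unions of at most $\kappa$ members). A map $a:I\to M$ is measurable if $a^{-1}(X)\in\mathscr A$ for every Borel $X\subseteq M$. If $M$ is $\mathscr A$-meanable, $M^\mu$ is the set of classes $[a_i]$ of measurable maps $a=(a_i)_{i\in I}$ modulo $a\sim b\iff\int d(a_i,b_i)^p\,d\mu=0$, with metric $d([a_i],[b_i])=(\int d(a_i,b_i)^p\,d\mu)^{1/p}$, $c^{M^\mu}=[c^M]$, $F^{M^\mu}([a_i],\dots)=[F^M(a_i,\dots)]$, and $R^{M^\mu}([a_i],\dots)=\int R^M(a_i,\dots)\,d\mu$ for non-metric $R$; it is a $\tau$-structure. *)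

theory Defs
  imports "HOL-Analysis.Analysis"
begin

unbundle cardinal_syntax

definition modulus :: "(real \<Rightarrow> real) \<Rightarrow> bool" where
  "modulus l \<longleftrightarrow> l ` {0..} \<subseteq> {0..} \<and> l 0 = 0 \<and> mono_on {0..} l
     \<and> continuous_on {0..} l \<and> concave_on {0..} l"

text \<open>The symbols of a signature are the members of the three sets \<open>sig_funs\<close>, \<open>sig_rels\<close>,
  \<open>sig_consts\<close>, any of which may be empty. The distinguished metric symbol with bound \<open>1\<close> belongs
  to every signature and is therefore built into structures and formulas; \<open>sig_rels\<close> contains
  the relation symbols other than the metric.\<close>

record ('f, 'r, 'c) signature =
  sig_funs :: "'f set"
  sig_rels :: "'r set"
  sig_consts :: "'c set"
  fun_arity :: "'f \<Rightarrow> nat"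
  fun_modulus :: "'f \<Rightarrow> real \<Rightarrow> real"
  rel_arity :: "'r \<Rightarrow> nat"
  rel_modulus :: "'r \<Rightarrow> real \<Rightarrow> real"
  rel_bound :: "'r \<Rightarrow> real"

definition wf_signature :: "('f, 'r, 'c) signature \<Rightarrow> bool" where
  "wf_signature \<tau> \<longleftrightarrow>
     (\<forall>F \<in> sig_funs \<tau>. modulus (fun_modulus \<tau> F)) \<and>
     (\<forall>R \<in> sig_rels \<tau>. modulus (rel_modulus \<tau> R) \<and> 0 \<le> rel_bound \<tau> R)"

text \<open>Tuples are lists; the interpretation of a symbol matters only on tuples of the right length
  from the carrier.\<close>

record ('a, 'f, 'r, 'c) struct =
  str_carrier :: "'a set"
  str_dist :: "'a \<Rightarrow> 'a \<Rightarrow> real"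
  str_fun :: "'f \<Rightarrow> 'a list \<Rightarrow> 'a"
  str_rel :: "'r \<Rightarrow> 'a list \<Rightarrow> real"
  str_const :: "'c \<Rightarrow> 'a"

definition tuples :: "'a set \<Rightarrow> nat \<Rightarrow> 'a list set" where
  "tuples X n = {xs. set xs \<subseteq> X \<and> length xs = n}"

definition tuple_dist :: "real \<Rightarrow> ('a \<Rightarrow> 'a \<Rightarrow> real) \<Rightarrow> 'a list \<Rightarrow> 'a list \<Rightarrow> real" where
  "tuple_dist p d xs ys = (\<Sum>k<length xs. d (xs ! k) (ys ! k) powr p) powr (1 / p)"

definition structure_on ::
  "real \<Rightarrow> ('f, 'r, 'c) signature \<Rightarrow> ('a, 'f, 'r, 'c) struct \<Rightarrow> bool" where
  "structure_on p \<tau> M \<longleftrightarrow>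
     Metric_space (str_carrier M) (str_dist M) \<and>
     str_carrier M \<noteq> {} \<and>
     (\<forall>x \<in> str_carrier M. \<forall>y \<in> str_carrier M. str_dist M x y \<le> 1) \<and>
     (\<forall>c \<in> sig_consts \<tau>. str_const M c \<in> str_carrier M) \<and>
     (\<forall>F \<in> sig_funs \<tau>.
        (\<forall>xs \<in> tuples (str_carrier M) (fun_arity \<tau> F). str_fun M F xs \<in> str_carrier M) \<and>
        (\<forall>xs \<in> tuples (str_carrier M) (fun_arity \<tau> F).
          \<forall>ys \<in> tuples (str_carrier M) (fun_arity \<tau> F).
           str_dist M (str_fun M F xs) (str_fun M F ys)
             \<le> fun_modulus \<tau> F (tuple_dist p (str_dist M) xs ys))) \<and>
     (\<forall>R \<in> sig_rels \<tau>.
        (\<forall>xs \<in> tuples (str_carrier M) (rel_arity \<tau> R). \<bar>str_rel M R xs\<bar> \<le> rel_bound \<tau> R) \<and>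
        (\<forall>xs \<in> tuples (str_carrier M) (rel_arity \<tau> R).
          \<forall>ys \<in> tuples (str_carrier M) (rel_arity \<tau> R).
           \<bar>str_rel M R xs - str_rel M R ys\<bar>
             \<le> rel_modulus \<tau> R (tuple_dist p (str_dist M) xs ys)))"

definition complete_struct :: "('a, 'f, 'r, 'c) struct \<Rightarrow> bool" where
  "complete_struct M \<longleftrightarrow> Metric_space.mcomplete (str_carrier M) (str_dist M)"

definition struct_iso ::
  "('f, 'r, 'c) signature \<Rightarrow> ('a, 'f, 'r, 'c) struct \<Rightarrow> ('b, 'f, 'r, 'c) struct \<Rightarrow> ('a \<Rightarrow> 'b) \<Rightarrow> bool"
where
  "struct_iso \<tau> M N h \<longleftrightarrow>
     bij_betw h (str_carrier M) (str_carrier N) \<and>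
     (\<forall>x \<in> str_carrier M. \<forall>y \<in> str_carrier M. str_dist N (h x) (h y) = str_dist M x y) \<and>
     (\<forall>c \<in> sig_consts \<tau>. h (str_const M c) = str_const N c) \<and>
     (\<forall>F \<in> sig_funs \<tau>. \<forall>xs \<in> tuples (str_carrier M) (fun_arity \<tau> F).
        h (str_fun M F xs) = str_fun N F (map h xs)) \<and>
     (\<forall>R \<in> sig_rels \<tau>. \<forall>xs \<in> tuples (str_carrier M) (rel_arity \<tau> R).
        str_rel N R (map h xs) = str_rel M R xs)"

definition isomorphic_structs ::
  "('f, 'r, 'c) signature \<Rightarrow> ('a, 'f, 'r, 'c) struct \<Rightarrow> ('b, 'f, 'r, 'c) struct \<Rightarrow> bool" where
  "isomorphic_structs \<tau> M N \<longleftrightarrow> (\<exists>h. struct_iso \<tau> M N h)"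

datatype ('f, 'c) trm =
    Var nat
  | Cst 'c
  | App 'f "('f, 'c) trm list"

text \<open>\<open>DistP t u\<close> stands for the atomic formula that is the \<open>p\<close>-th power of the distance of
  \<open>t\<close> and \<open>u\<close>.\<close>

datatype ('f, 'r, 'c) fm =
    Real real
  | DistP "('f, 'c) trm" "('f, 'c) trm"
  | Rel 'r "('f, 'c) trm list"
  | Scale real "('f, 'r, 'c) fm"
  | Plus "('f, 'r, 'c) fm" "('f, 'r, 'c) fm"
  | SupF nat "('f, 'r, 'c) fm"
  | InfF nat "('f, 'r, 'c) fm"

fun wf_trm :: "('f, 'r, 'c) signature \<Rightarrow> ('f, 'c) trm \<Rightarrow> bool" where
  "wf_trm \<tau> (Var n) \<longleftrightarrow> True"
| "wf_trm \<tau> (Cst c) \<longleftrightarrow> c \<in> sig_consts \<tau>"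
| "wf_trm \<tau> (App F ts) \<longleftrightarrow>
     F \<in> sig_funs \<tau> \<and> length ts = fun_arity \<tau> F \<and> (\<forall>t \<in> set ts. wf_trm \<tau> t)"

fun wf_fm :: "('f, 'r, 'c) signature \<Rightarrow> ('f, 'r, 'c) fm \<Rightarrow> bool" where
  "wf_fm \<tau> (Real r) \<longleftrightarrow> True"
| "wf_fm \<tau> (DistP t u) \<longleftrightarrow> wf_trm \<tau> t \<and> wf_trm \<tau> u"
| "wf_fm \<tau> (Rel R ts) \<longleftrightarrow>
     R \<in> sig_rels \<tau> \<and> length ts = rel_arity \<tau> R \<and> (\<forall>t \<in> set ts. wf_trm \<tau> t)"
| "wf_fm \<tau> (Scale r \<phi>) \<longleftrightarrow> wf_fm \<tau> \<phi>"
| "wf_fm \<tau> (Plus \<phi> \<psi>) \<longleftrightarrow> wf_fm \<tau> \<phi> \<and> wf_fm \<tau> \<psi>"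
| "wf_fm \<tau> (SupF n \<phi>) \<longleftrightarrow> wf_fm \<tau> \<phi>"
| "wf_fm \<tau> (InfF n \<phi>) \<longleftrightarrow> wf_fm \<tau> \<phi>"

fun trm_vars :: "('f, 'c) trm \<Rightarrow> nat set" where
  "trm_vars (Var n) = {n}"
| "trm_vars (Cst c) = {}"
| "trm_vars (App F ts) = (\<Union>t \<in> set ts. trm_vars t)"

fun free_vars :: "('f, 'r, 'c) fm \<Rightarrow> nat set" where
  "free_vars (Real r) = {}"
| "free_vars (DistP t u) = trm_vars t \<union> trm_vars u"
| "free_vars (Rel R ts) = (\<Union>t \<in> set ts. trm_vars t)"
| "free_vars (Scale r \<phi>) = free_vars \<phi>"
| "free_vars (Plus \<phi> \<psi>) = free_vars \<phi> \<union> free_vars \<psi>"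
| "free_vars (SupF n \<phi>) = free_vars \<phi> - {n}"
| "free_vars (InfF n \<phi>) = free_vars \<phi> - {n}"

definition is_sentence :: "('f, 'r, 'c) signature \<Rightarrow> ('f, 'r, 'c) fm \<Rightarrow> bool" where
  "is_sentence \<tau> \<sigma> \<longleftrightarrow> wf_fm \<tau> \<sigma> \<and> free_vars \<sigma> = {}"

primrec trm_val :: "('a, 'f, 'r, 'c) struct \<Rightarrow> (nat \<Rightarrow> 'a) \<Rightarrow> ('f, 'c) trm \<Rightarrow> 'a" where
  "trm_val M s (Var n) = s n"
| "trm_val M s (Cst c) = str_const M c"
| "trm_val M s (App F ts) = str_fun M F (map (trm_val M s) ts)"

primrec fm_val :: "real \<Rightarrow> ('a, 'f, 'r, 'c) struct \<Rightarrow> ('f, 'r, 'c) fm \<Rightarrow> (nat \<Rightarrow> 'a) \<Rightarrow> real" where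
  "fm_val p M (Real r) = (\<lambda>s. r)"
| "fm_val p M (DistP t u) = (\<lambda>s. str_dist M (trm_val M s t) (trm_val M s u) powr p)"
| "fm_val p M (Rel R ts) = (\<lambda>s. str_rel M R (map (trm_val M s) ts))"
| "fm_val p M (Scale r \<phi>) = (\<lambda>s. r * fm_val p M \<phi> s)"
| "fm_val p M (Plus \<phi> \<psi>) = (\<lambda>s. fm_val p M \<phi> s + fm_val p M \<psi> s)"
| "fm_val p M (SupF n \<phi>) = (\<lambda>s. SUP x \<in> str_carrier M. fm_val p M \<phi> (s(n := x)))"
| "fm_val p M (InfF n \<phi>) = (\<lambda>s. INF x \<in> str_carrier M. fm_val p M \<phi> (s(n := x)))"

text \<open>The value of a sentence does not depend on the assignment of the variables; the one used
  here is an arbitrary constant assignment with value in the carrier.\<close>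

definition sentence_val :: "real \<Rightarrow> ('a, 'f, 'r, 'c) struct \<Rightarrow> ('f, 'r, 'c) fm \<Rightarrow> real" where
  "sentence_val p M \<sigma> = fm_val p M \<sigma> (\<lambda>_. SOME x. x \<in> str_carrier M)"

definition elem_equiv ::
  "real \<Rightarrow> ('f, 'r, 'c) signature \<Rightarrow> ('a, 'f, 'r, 'c) struct \<Rightarrow> ('b, 'f, 'r, 'c) struct \<Rightarrow> bool" where
  "elem_equiv p \<tau> M N \<longleftrightarrow>
     (\<forall>\<sigma>. is_sentence \<tau> \<sigma> \<longrightarrow> sentence_val p M \<sigma> = sentence_val p N \<sigma>)"

definition charge_space :: "'i set \<Rightarrow> 'i set set \<Rightarrow> ('i set \<Rightarrow> real) \<Rightarrow> bool" where
  "charge_space I \<A> \<mu> \<longleftrightarrow>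
     algebra I \<A> \<and>
     (\<forall>X \<in> \<A>. 0 \<le> \<mu> X) \<and>
     (\<forall>X \<in> \<A>. \<forall>Y \<in> \<A>. X \<inter> Y = {} \<longrightarrow> \<mu> (X \<union> Y) = \<mu> X + \<mu> Y) \<and>
     \<mu> I = 1"

definition simple_on :: "'i set \<Rightarrow> 'i set set \<Rightarrow> ('i \<Rightarrow> real) \<Rightarrow> bool" where
  "simple_on I \<A> s \<longleftrightarrow> finite (s ` I) \<and> (\<forall>c. s -` {c} \<inter> I \<in> \<A>)"

definition simple_charge_integral :: "'i set \<Rightarrow> ('i set \<Rightarrow> real) \<Rightarrow> ('i \<Rightarrow> real) \<Rightarrow> real" where
  "simple_charge_integral I \<mu> s = (\<Sum>c \<in> s ` I. c * \<mu> (s -` {c} \<inter> I))"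

definition charge_integral ::
  "'i set \<Rightarrow> 'i set set \<Rightarrow> ('i set \<Rightarrow> real) \<Rightarrow> ('i \<Rightarrow> real) \<Rightarrow> real" where
  "charge_integral I \<A> \<mu> f =
     (THE L. \<exists>s. (\<forall>n. simple_on I \<A> (s n)) \<and> uniform_limit I s f sequentially \<and>
       (\<lambda>n. simple_charge_integral I \<mu> (s n)) \<longlonglongrightarrow> L)"

definition str_topology :: "('a, 'f, 'r, 'c) struct \<Rightarrow> 'a topology" where
  "str_topology M = Metric_space.mtopology (str_carrier M) (str_dist M)"

definition str_borel :: "('a, 'f, 'r, 'c) struct \<Rightarrow> 'a set set" where
  "str_borel M = sigma_sets (str_carrier M) {U. openin (str_topology M) U}"

definition union_complete :: "'k rel \<Rightarrow> 'i set set \<Rightarrow> bool" where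
  "union_complete \<kappa> \<A> \<longleftrightarrow> (\<forall>\<F>. \<F> \<subseteq> \<A> \<and> |\<F>| \<le>o \<kappa> \<longrightarrow> \<Union>\<F> \<in> \<A>)"

text \<open>The cardinal \<open>\<kappa>\<close> may be taken on the type of the points of \<open>M\<close>: if some cardinal works,
  then so does the cardinality of a dense subset witnessing this.\<close>

definition meanable :: "'i set set \<Rightarrow> ('a, 'f, 'r, 'c) struct \<Rightarrow> bool" where
  "meanable \<A> M \<longleftrightarrow>
     (\<exists>\<kappa> :: 'a rel. Card_order \<kappa> \<and>
        (\<exists>D \<subseteq> str_carrier M. str_topology M closure_of D = str_carrier M \<and> |D| \<le>o \<kappa>) \<and>
        union_complete \<kappa> \<A>)"

definition meas_maps :: "'i set \<Rightarrow> 'i set set \<Rightarrow> ('a, 'f, 'r, 'c) struct \<Rightarrow> ('i \<Rightarrow> 'a) set" where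
  "meas_maps I \<A> M = {a \<in> I \<rightarrow>\<^sub>E str_carrier M. \<forall>X \<in> str_borel M. a -` X \<inter> I \<in> \<A>}"

definition mean_rel ::
  "real \<Rightarrow> 'i set \<Rightarrow> 'i set set \<Rightarrow> ('i set \<Rightarrow> real) \<Rightarrow> ('a, 'f, 'r, 'c) struct \<Rightarrow> ('i \<Rightarrow> 'a) rel" where
  "mean_rel p I \<A> \<mu> M =
     {(a, b). a \<in> meas_maps I \<A> M \<and> b \<in> meas_maps I \<A> M \<and>
        charge_integral I \<A> \<mu> (\<lambda>i. str_dist M (a i) (b i) powr p) = 0}"

text \<open>A class of measurable maps is evaluated through an arbitrary representative; the operations
  below do not depend on its choice when \<open>M\<close> is meanable.\<close>

definition repr :: "('i \<Rightarrow> 'a) set \<Rightarrow> 'i \<Rightarrow> 'a" where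
  "repr A = (SOME a. a \<in> A)"

definition powermean ::
  "real \<Rightarrow> 'i set \<Rightarrow> 'i set set \<Rightarrow> ('i set \<Rightarrow> real) \<Rightarrow> ('a, 'f, 'r, 'c) struct
     \<Rightarrow> (('i \<Rightarrow> 'a) set, 'f, 'r, 'c) struct" where
  "powermean p I \<A> \<mu> M =
     \<lparr> str_carrier = meas_maps I \<A> M // mean_rel p I \<A> \<mu> M,
       str_dist = (\<lambda>A B.
         charge_integral I \<A> \<mu> (\<lambda>i. str_dist M (repr A i) (repr B i) powr p) powr (1 / p)),
       str_fun = (\<lambda>F As.
         mean_rel p I \<A> \<mu> M `` {\<lambda>i \<in> I. str_fun M F (map (\<lambda>A. repr A i) As)}),
       str_rel = (\<lambda>R As.
         charge_integral I \<A> \<mu> (\<lambda>i. str_rel M R (map (\<lambda>A. repr A i) As))),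
       str_const = (\<lambda>c. mean_rel p I \<A> \<mu> M `` {\<lambda>i \<in> I. str_const M c}) \<rparr>"

text \<open>Types cannot be quantified existentially, so the index set of the charge space is sought
  among the subsets of one large type. This loses no generality: given an isomorphism of the
  powermeans of nonempty \<open>M\<close> and \<open>N\<close> over some charge space, one may pass to a sufficiently
  complete subalgebra of cardinality at most \<open>2^max(\<aleph>\<^sub>0,|M|,|N|)\<close> that still contains the preimages
  under measurable representatives of corresponding classes, and then to a set of that many indices
  meeting all of its nonempty members. The type below is larger than needed for this.\<close>

type_synonym ('a, 'b) index = "(nat + 'a + 'b) set set set set"

end

theory Submission
  imports Defs
begin

text \<open>The index set is a product of copies of \<open>M \<times> N\<close> whose coordinates are well-founded trees. A
  coordinate \<open>t\<close> carries a map \<open>P t\<close> into \<open>M\<close> and a map \<open>Q t\<close> into \<open>N\<close>: one of them is a free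
  component of the coordinate, the other one may be prescribed as a function of the coordinates
  below. Hence, for the algebra of sets depending on at most \<open>max(\<aleph>\<^sub>0,|M|,|N|)\<close> coordinates, the
  \<open>P t\<close> are all the measurable maps into \<open>M\<close> and the \<open>Q t\<close> all those into \<open>N\<close>, and the isomorphism
  is \<open>[P t] \<mapsto> [Q t]\<close>. It exists as soon as a mean gives \<open>\<phi>(P t\<^sub>1,\<dots>)\<close> and \<open>\<phi>(Q t\<^sub>1,\<dots>)\<close> the same
  integral for every quantifier-free \<open>\<phi>\<close>. By the Hahn-Banach theorem such a mean exists if no
  difference of two such functions is bounded below by a positive number. To see this, eliminate
  the trees one by one, each time one on which none of the others depends: its free component is
  chosen so as to approach a supremum in \<open>N\<close> or an infimum in \<open>M\<close>. In the end a sentence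
  remains, which has the same value in \<open>M\<close> and \<open>N\<close>.\<close>

section \<open>Means on bounded functions\<close>

text \<open>An isomorphism of the powermeans has to respect distances, constants, functions and
  relations only, and all of these can be read off from integrals of atomic formulas; this is why
  balancing the quantifier-free formulas suffices. The obstacle is that every measurable map on
  either side needs a partner on the other, while enlarging an index set to supply partners creates
  new measurable maps. Trees settle this in one step: the partners are present as coordinates from
  the start, and the recursion is absorbed into well-foundedness. In the elimination the prescribed
  component may depend on the lower coordinates in any way whatsoever, because the value of the
  formula there lies below the supremum in \<open>M\<close>, or above the infimum in
  \<open>N\<close>; only the free component is chosen. The Hahn-Banach theorem applies because
  formulas are closed under linear combinations: the differences of the two evaluations form a
  vector space, and a one-sided estimate valid on a whole vector space controls both signs.\<close>

definition mean :: "(('i \<Rightarrow> real) \<Rightarrow> real) \<Rightarrow> bool" where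
  "mean L \<longleftrightarrow>
     (\<forall>f g. bounded (range f) \<longrightarrow> bounded (range g) \<longrightarrow> L (\<lambda>i. f i + g i) = L f + L g) \<and>
     (\<forall>f c. bounded (range f) \<longrightarrow> L (\<lambda>i. c * f i) = c * L f) \<and>
     (\<forall>f. bounded (range f) \<longrightarrow> (\<forall>i. 0 \<le> f i) \<longrightarrow> 0 \<le> L f) \<and>
     L (\<lambda>_. 1) = 1"

text \<open>Only one half of homogeneity is demanded, so that a candidate obtained as an infimum is
  quick to check. Applying it to the factor \<open>1 / c\<close> as well gives equality.\<close>

definition sublinear :: "(('i \<Rightarrow> real) \<Rightarrow> real) \<Rightarrow> bool" where
  "sublinear q \<longleftrightarrow>
     (\<forall>f g. bounded (range f) \<longrightarrow> bounded (range g) \<longrightarrow> q (\<lambda>i. f i + g i) \<le> q f + q g) \<and>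
     (\<forall>f c. bounded (range f) \<longrightarrow> 0 < c \<longrightarrow> q (\<lambda>i. c * f i) \<le> c * q f)"

lemma bounded_range_iff: "bounded (range f) \<longleftrightarrow> (\<exists>B. \<forall>i. \<bar>f i :: real\<bar> \<le> B)"
  by (auto simp: bounded_iff)

lemma bounded_range_add:
  "bounded (range f) \<Longrightarrow> bounded (range g) \<Longrightarrow> bounded (range (\<lambda>i. f i + g i :: real))"
  by (auto simp: bounded_range_iff) (meson abs_triangle_ineq add_mono order_trans)

lemma bounded_range_cmult:
  "bounded (range f) \<Longrightarrow> bounded (range (\<lambda>i. c * f i :: real))"
  by (auto simp: bounded_range_iff abs_mult) (meson abs_ge_zero mult_left_mono)

lemma bounded_range_minus:
  "bounded (range f) \<Longrightarrow> bounded (range (\<lambda>i. - f i :: real))"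
  by (auto simp: bounded_range_iff)

lemma bounded_range_diff:
  "bounded (range f) \<Longrightarrow> bounded (range g) \<Longrightarrow> bounded (range (\<lambda>i. f i - g i :: real))"
  using bounded_range_add[of f "\<lambda>i. - g i"] bounded_range_minus[of g] by simp

lemma bounded_range_const: "bounded (range (\<lambda>_. c :: real))"
  by (auto simp: bounded_range_iff)

lemma bounded_range_sum:
  assumes "\<And>k. k \<in> K \<Longrightarrow> bounded (range (f k))"
  shows "bounded (range (\<lambda>i. \<Sum>k\<in>K. f k i :: real))"
  using assms
  by (induction K rule: infinite_finite_induct)
     (auto intro!: bounded_range_add bounded_range_const)

lemmas bounded_range_intros =
  bounded_range_add bounded_range_cmult bounded_range_minus bounded_range_diff
  bounded_range_const bounded_range_sum

section \<open>Sublinear functionals and the Hahn-Banach theorem\<close>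

lemma sublinear_add:
  "sublinear q \<Longrightarrow> bounded (range f) \<Longrightarrow> bounded (range g) \<Longrightarrow> q (\<lambda>i. f i + g i) \<le> q f + q g"
  by (simp add: sublinear_def)

lemma sublinear_cmult_le:
  "sublinear q \<Longrightarrow> bounded (range f) \<Longrightarrow> 0 < c \<Longrightarrow> q (\<lambda>i. c * f i) \<le> c * q f"
  by (simp add: sublinear_def)

lemma sublinear_zero:
  assumes "sublinear q" shows "q (\<lambda>_. 0) = 0"
proof -
  have "q (\<lambda>_. 0) \<le> 2 * q (\<lambda>_. 0)" "q (\<lambda>_. 0) \<le> (1/2) * q (\<lambda>_. 0)"
    using sublinear_cmult_le[OF assms bounded_range_const[of 0], of 2]
      sublinear_cmult_le[OF assms bounded_range_const[of 0], of "1/2"] by auto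
  then show ?thesis by simp
qed

lemma sublinear_cmult:
  assumes "sublinear q" "bounded (range f)" "0 \<le> c"
  shows "q (\<lambda>i. c * f i) = c * q f"
proof (cases "c = 0")
  case True
  then show ?thesis using sublinear_zero[OF assms(1)] by simp
next
  case False
  then have c: "c > 0" using assms(3) by simp
  have "q (\<lambda>i. (1/c) * (c * f i)) \<le> (1/c) * q (\<lambda>i. c * f i)"
    by (rule sublinear_cmult_le) (use assms c in \<open>auto intro: bounded_range_intros\<close>)
  then have "c * q f \<le> q (\<lambda>i. c * f i)"
    using c by (simp add: field_simps)
  then show ?thesis using sublinear_cmult_le[OF assms(1,2) c] by simp
qed

lemma sublinear_ge:
  assumes "sublinear q" "bounded (range f)"
  shows "- q (\<lambda>i. - f i) \<le> q f"
  using sublinear_add[OF assms bounded_range_minus[OF assms(2)]] sublinear_zero[OF assms(1)] by simp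

text \<open>Zorn's lemma for the reversed pointwise order. The infimum of a chain is finite at a
  bounded \<open>f\<close> because each member \<open>q\<close> satisfies
  \<open>- q0 (\<lambda>i. - f i) \<le> q f\<close>.\<close>

lemma sublinear_minimal_exists:
  fixes q0 :: "('i \<Rightarrow> real) \<Rightarrow> real"
  assumes "sublinear q0"
  shows "\<exists>q. sublinear q \<and> (\<forall>f. bounded (range f) \<longrightarrow> q f \<le> q0 f) \<and>
     (\<forall>q'. sublinear q' \<longrightarrow> (\<forall>f. bounded (range f) \<longrightarrow> q' f \<le> q f) \<longrightarrow>
        (\<forall>f. bounded (range f) \<longrightarrow> q' f = q f))"
proof -
  define S where "S = {q. sublinear q \<and> (\<forall>f. bounded (range f) \<longrightarrow> q f \<le> q0 f) \<and>
    (\<forall>f. \<not> bounded (range f) \<longrightarrow> q f = (0::real))}"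
  define P where "P = (\<lambda>q q'. \<forall>f :: 'i \<Rightarrow> real. q' f \<le> (q f :: real))"
  \<comment> \<open>Values at unbounded functions are fixed at 0, so that they disturb neither the
    infimum of a chain nor the comparison of two functionals.\<close>
  define cut where "cut = (\<lambda>q f. if bounded (range (f :: 'i \<Rightarrow> real)) then q f else (0::real))"
  have cut: "sublinear (cut q)" if "sublinear q" for q
    using that by (auto simp: sublinear_def cut_def bounded_range_intros)
  have "\<exists>m\<in>S. \<forall>a\<in>S. P m a \<longrightarrow> a = m"
  proof (rule predicate_Zorn)
    show "partial_order_on S (relation_of P S)"
      by (auto simp: partial_order_on_def preorder_on_def refl_on_def trans_def antisym_def
          relation_of_def P_def intro: order_trans) (rule ext, rule antisym, auto)
  next
    fix C assume "C \<in> Chains (relation_of P S)"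
    then have CS: "C \<subseteq> S" and tot: "\<And>a b. a \<in> C \<Longrightarrow> b \<in> C \<Longrightarrow> P a b \<or> P b a"
      by (auto simp: Chains_def relation_of_def)
    show "\<exists>u\<in>S. \<forall>a\<in>C. P a u"
    proof (cases "C = {}")
      case True
      have "cut q0 \<in> S" using cut[OF assms] by (auto simp: S_def cut_def)
      with True show ?thesis by blast
    next
      case False
      define u where "u = (\<lambda>f. INF q\<in>C. q f)"
      have sub: "sublinear q" "bounded (range f) \<Longrightarrow> q f \<le> q0 f"
        "\<not> bounded (range f) \<Longrightarrow> q f = 0" if "q \<in> C" for q f
        using that CS by (auto simp: S_def)
      have bd: "bdd_below ((\<lambda>q. q f) ` C)" for f
      proof (cases "bounded (range f)")
        case True
        have "- q0 (\<lambda>i. - f i) \<le> q f" if "q \<in> C" for q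
          using sublinear_ge[OF sub(1)[OF that] True]
            sub(2)[OF that, of "\<lambda>i. - f i"] True bounded_range_minus[OF True] by auto
        then show ?thesis by (auto intro!: bdd_belowI2)
      next
        case False
        then show ?thesis by (intro bdd_belowI2[where m = 0]) (simp add: sub(3))
      qed
      have le: "u f \<le> q f" if "q \<in> C" for q f
        unfolding u_def by (rule cINF_lower[OF bd that])
      have add: "u (\<lambda>i. f i + g i) \<le> u f + u g"
        if b: "bounded (range f)" "bounded (range g)" for f g
      proof -
        have 1: "u (\<lambda>i. f i + g i) \<le> q1 f + q2 g" if q: "q1 \<in> C" "q2 \<in> C" for q1 q2
        proof -
          \<comment> \<open>In a chain the smaller of \<open>q1\<close> and \<open>q2\<close> can
            serve for both summands.\<close>
          consider "P q1 q2" | "P q2 q1" using tot[OF q] by blast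
          then show ?thesis
          proof cases
            case 1
            have "u (\<lambda>i. f i + g i) \<le> q2 f + q2 g"
              using le[OF q(2)] sublinear_add[OF sub(1)[OF q(2)] b] by (meson order_trans)
            also have "q2 f \<le> q1 f" using 1 by (simp add: P_def)
            finally show ?thesis by simp
          next
            case 2
            have "u (\<lambda>i. f i + g i) \<le> q1 f + q1 g"
              using le[OF q(1)] sublinear_add[OF sub(1)[OF q(1)] b] by (meson order_trans)
            also have "q1 g \<le> q2 g" using 2 by (simp add: P_def)
            finally show ?thesis by simp
          qed
        qed
        have "u (\<lambda>i. f i + g i) - q1 f \<le> u g" if "q1 \<in> C" for q1
          using 1[OF that] by (subst (2) u_def) (rule cINF_greatest[OF False], simp add: diff_le_eq add.commute)
        then have "u (\<lambda>i. f i + g i) - u g \<le> q1 f" if "q1 \<in> C" for q1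
          using that by (metis diff_le_eq add.commute)
        then have "u (\<lambda>i. f i + g i) - u g \<le> u f"
          by (subst (3) u_def) (rule cINF_greatest[OF False], auto)
        then show ?thesis by simp
      qed
      have cm: "u (\<lambda>i. c * f i) \<le> c * u f" if b: "bounded (range f)" "c > 0" for f c
      proof -
        have "u (\<lambda>i. c * f i) / c \<le> q f" if "q \<in> C" for q
          using le[OF that, of "\<lambda>i. c * f i"] sublinear_cmult_le[OF sub(1)[OF that] b] b(2)
          by (simp add: field_simps)
        then have "u (\<lambda>i. c * f i) / c \<le> u f"
          by (subst (2) u_def) (rule cINF_greatest[OF False], auto)
        then show ?thesis using b(2) by (simp add: field_simps)
      qed
      obtain q where q: "q \<in> C" using False by blast
      have "u f \<le> q0 f" if "bounded (range f)" for f
        using le[OF q] sub(2)[OF q that] by (meson order_trans)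
      moreover have "u f = 0" if "\<not> bounded (range f)" for f
      proof -
        have "u f = (INF q\<in>C. 0)" unfolding u_def by (rule INF_cong) (simp_all add: sub(3)[OF _ that])
        then show ?thesis using False by simp
      qed
      ultimately have "u \<in> S" using add cm by (auto simp: S_def sublinear_def)
      moreover have "\<forall>a\<in>C. P a u" using le by (auto simp: P_def)
      ultimately show ?thesis by blast
    qed
  qed
  then obtain m where m: "m \<in> S" "\<And>a. a \<in> S \<Longrightarrow> P m a \<Longrightarrow> a = m" by blast
  have "q' f = m f" if q': "sublinear q'" "\<forall>f. bounded (range f) \<longrightarrow> q' f \<le> m f"
    and f: "bounded (range f)" for q' f
  proof -
    have "cut q' \<in> S"
    proof -
      have "q' f \<le> q0 f" if "bounded (range f)" for f
        using m(1) q'(2) that by (auto simp: S_def intro: order_trans)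
      then show ?thesis using cut[OF q'(1)] by (auto simp: S_def cut_def)
    qed
    moreover have "P m (cut q')"
      using q'(2) m(1) by (auto simp: P_def cut_def S_def)
    ultimately have "cut q' = m" by (rule m(2))
    then show ?thesis using f by (auto simp: cut_def)
  qed
  then show ?thesis using m(1) by (intro exI[of _ m]) (auto simp: S_def)
qed

text \<open>A minimal sublinear functional is linear: otherwise the functional
  \<open>f \<mapsto> inf\<^sub>t q (f + t g) - t q g\<close> lies below it and has the value \<open>- q g\<close> at \<open>- g\<close>.\<close>

lemma hahn_banach_bounded:
  fixes q0 :: "('i \<Rightarrow> real) \<Rightarrow> real"
  assumes "sublinear q0"
  shows "\<exists>q. sublinear q \<and> (\<forall>f. bounded (range f) \<longrightarrow> q f \<le> q0 f) \<and>
     (\<forall>f. bounded (range f) \<longrightarrow> q (\<lambda>i. - f i) = - q f)"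
proof -
  obtain q where q: "sublinear q" "\<And>f. bounded (range f) \<Longrightarrow> q f \<le> q0 f"
    and min: "\<And>q' f. sublinear q' \<Longrightarrow> (\<And>f. bounded (range f) \<Longrightarrow> q' f \<le> q f) \<Longrightarrow>
       bounded (range f) \<Longrightarrow> q' f = q f"
    using sublinear_minimal_exists[OF assms] by metis
  have "q (\<lambda>i. - g i) \<le> - q g" if g: "bounded (range g)" for g
  proof -
    define e where "e = (\<lambda>f t. q (\<lambda>i. f i + t * g i) - t * q g)"
    define q' where "q' = (\<lambda>f. INF t\<in>{0..}. e f t)"
    have bd: "bdd_below (e f ` {0..})" if f: "bounded (range f)" for f
    proof (rule bdd_belowI2)
      fix t :: real assume "t \<in> {0..}"
      then have "t * q g = q (\<lambda>i. (f i + t * g i) + - f i)"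
        using sublinear_cmult[OF q(1) g] by simp
      also have "\<dots> \<le> q (\<lambda>i. f i + t * g i) + q (\<lambda>i. - f i)"
        by (rule sublinear_add[OF q(1)]) (use f g in \<open>auto intro!: bounded_range_intros\<close>)
      finally show "- q (\<lambda>i. - f i) \<le> e f t" by (simp add: e_def)
    qed
    have le: "q' f \<le> e f t" if "bounded (range f)" "0 \<le> t" for f t
      unfolding q'_def by (rule cINF_lower[OF bd]) (use that in auto)
    have ge: "x \<le> q' f" if "\<And>t. 0 \<le> t \<Longrightarrow> x \<le> e f t" for x f
      unfolding q'_def by (rule cINF_greatest) (use that in auto)
    have add: "q' (\<lambda>i. f i + h i) \<le> q' f + q' h"
      if b: "bounded (range f)" "bounded (range h)" for f h
    proof -
      \<comment> \<open>The parameters \<open>s\<close> and \<open>t\<close> of the two infima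
        combine to \<open>s + t\<close>; in the homogeneity below, \<open>t\<close> turns into
        \<open>c * t\<close> in the same way.\<close>
      have "q' (\<lambda>i. f i + h i) \<le> e f s + e h t" if st: "0 \<le> s" "0 \<le> t" for s t
      proof -
        have "q' (\<lambda>i. f i + h i) \<le> e (\<lambda>i. f i + h i) (s + t)"
          by (rule le) (use b st in \<open>auto intro!: bounded_range_intros\<close>)
        also have "\<dots> = q (\<lambda>i. (f i + s * g i) + (h i + t * g i)) - (s + t) * q g"
          by (simp add: e_def algebra_simps)
        also have "\<dots> \<le> q (\<lambda>i. f i + s * g i) + q (\<lambda>i. h i + t * g i) - (s + t) * q g"
          using sublinear_add[OF q(1) bounded_range_add[OF b(1) bounded_range_cmult[OF g]]
              bounded_range_add[OF b(2) bounded_range_cmult[OF g]]]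
          by simp
        finally show ?thesis by (simp add: e_def algebra_simps)
      qed
      then have "q' (\<lambda>i. f i + h i) - e f s \<le> q' h" if "0 \<le> s" for s
        using that by (intro ge) (simp add: algebra_simps)
      then have "q' (\<lambda>i. f i + h i) - q' h \<le> q' f"
        by (intro ge) (simp add: algebra_simps)
      then show ?thesis by simp
    qed
    have cm: "q' (\<lambda>i. c * f i) \<le> c * q' f" if b: "bounded (range f)" "0 < c" for f c
    proof -
      have "q' (\<lambda>i. c * f i) / c \<le> e f t" if t: "0 \<le> t" for t
      proof -
        have "q' (\<lambda>i. c * f i) \<le> e (\<lambda>i. c * f i) (c * t)"
          by (rule le) (use b t in \<open>auto intro!: bounded_range_intros\<close>)
        also have "\<dots> = q (\<lambda>i. c * (f i + t * g i)) - c * t * q g"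
          by (simp add: e_def algebra_simps)
        also have "\<dots> \<le> c * e f t"
          using sublinear_cmult_le[OF q(1) bounded_range_add[OF b(1) bounded_range_cmult[OF g, of t]] b(2)]
          by (simp add: e_def algebra_simps)
        finally show ?thesis using b(2) by (simp add: field_simps)
      qed
      then have "q' (\<lambda>i. c * f i) / c \<le> q' f" by (rule ge)
      then show ?thesis using b(2) by (simp add: field_simps)
    qed
    have "q' f = q f" if "bounded (range f)" for f
    proof (rule min[OF _ _ that])
      show "sublinear q'" using add cm by (auto simp: sublinear_def)
      show "q' f \<le> q f" if "bounded (range f)" for f
        using le[OF that, of 0] by (simp add: e_def)
    qed
    then have "q (\<lambda>i. - g i) = q' (\<lambda>i. - g i)"
      using g by (simp add: bounded_range_minus)
    also have "\<dots> \<le> e (\<lambda>i. - g i) 1"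
      by (rule le) (use g in \<open>auto intro: bounded_range_minus\<close>)
    also have "\<dots> = - q g" using sublinear_zero[OF q(1)] by (simp add: e_def)
    finally show ?thesis .
  qed
  then have "q (\<lambda>i. - g i) = - q g" if "bounded (range g)" for g
    using sublinear_ge[OF q(1) that] that by force
  then show ?thesis using q by blast
qed

text \<open>Let \<open>q0 f\<close> be the infimum over \<open>v \<in> V\<close> of the least upper
  bound of \<open>f + v\<close>. Since no member of \<open>V\<close> is bounded below by a positive
  number, \<open>q0\<close> is finite. A linear functional below \<open>q0\<close> is positive,
  takes the value 1 at 1, and is at most 0 on \<open>V\<close>, hence 0 there because
  \<open>V\<close> is closed under negation.\<close>

lemma mean_exists:
  fixes V :: "('i \<Rightarrow> real) set"
  assumes bdd: "\<And>v. v \<in> V \<Longrightarrow> bounded (range v)"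
    and ne: "V \<noteq> {}"
    and add: "\<And>v w. v \<in> V \<Longrightarrow> w \<in> V \<Longrightarrow> (\<lambda>i. v i + w i) \<in> V"
    and cmult: "\<And>c v. v \<in> V \<Longrightarrow> (\<lambda>i. c * v i) \<in> V"
    and small: "\<And>v e. v \<in> V \<Longrightarrow> 0 < e \<Longrightarrow> \<exists>i. v i < e"
  shows "\<exists>L. mean L \<and> (\<forall>v\<in>V. L v = 0)"
proof -
  define q0 where "q0 = (\<lambda>f. Inf {c. \<exists>v\<in>V. \<forall>i. f i + v i \<le> (c::real)})"
  have nonempty: "{c. \<exists>v\<in>V. \<forall>i. f i + v i \<le> c} \<noteq> {}" if f: "bounded (range f)" for f
  proof -
    obtain v where v: "v \<in> V" using ne by blast
    then obtain B where "\<forall>i. \<bar>f i + v i\<bar> \<le> B"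
      using bounded_range_add[OF f bdd[OF v]] by (auto simp: bounded_range_iff)
    then have "\<forall>i. f i + v i \<le> B" by (simp add: abs_le_iff)
    then show ?thesis using v by blast
  qed
  have lower: "- B \<le> c" if B: "\<forall>i. \<bar>f i\<bar> \<le> B" and c: "v \<in> V" "\<forall>i. f i + v i \<le> c" for f B c v
  proof (rule field_le_epsilon)
    fix e :: real assume "0 < e"
    have "(\<lambda>i. - 1 * v i) \<in> V" by (rule cmult[OF c(1)])
    from small[OF this \<open>0 < e\<close>] obtain i where i: "- 1 * v i < e" ..
    moreover have "f i + v i \<le> c" "\<bar>f i\<bar> \<le> B" using B c(2) by simp_all
    ultimately show "- B \<le> c + e" by linarith
  qed
  have le: "q0 f \<le> c" if *: "bounded (range f)" "v \<in> V" "\<And>i. f i + v i \<le> c" for f c v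
  proof -
    obtain B where B: "\<forall>i. \<bar>f i\<bar> \<le> B" using *(1) by (auto simp: bounded_range_iff)
    have "bdd_below {c. \<exists>v\<in>V. \<forall>i. f i + v i \<le> c}"
    proof (rule bdd_belowI[of _ "- B"])
      fix x assume "x \<in> {c. \<exists>v\<in>V. \<forall>i. f i + v i \<le> c}"
      then obtain w where "w \<in> V" "\<forall>i. f i + w i \<le> x" by blast
      then show "- B \<le> x" by (rule lower[OF B])
    qed
    then show ?thesis
      unfolding q0_def using *(2,3) by (intro cInf_lower) blast+
  qed
  have ge: "x \<le> q0 f"
    if "bounded (range f)" "\<And>v c. v \<in> V \<Longrightarrow> (\<And>i. f i + v i \<le> c) \<Longrightarrow> x \<le> c" for f x
    unfolding q0_def
  proof (rule cInf_greatest[OF nonempty[OF that(1)]])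
    fix c assume "c \<in> {c. \<exists>v\<in>V. \<forall>i. f i + v i \<le> c}"
    then obtain w where "w \<in> V" "\<forall>i. f i + w i \<le> c" by blast
    then show "x \<le> c" by (intro that(2)) auto
  qed
  have "sublinear q0"
    unfolding sublinear_def
  proof (intro conjI allI impI)
    fix f g :: "'i \<Rightarrow> real" assume b: "bounded (range f)" "bounded (range g)"
    have "q0 (\<lambda>i. f i + g i) \<le> c + d"
      if "v \<in> V" "\<And>i. f i + v i \<le> c" "w \<in> V" "\<And>i. g i + w i \<le> d" for v c w d
    proof (rule le[OF bounded_range_add[OF b] add[OF that(1,3)]])
      fix i show "f i + g i + (v i + w i) \<le> c + d" using that(2)[of i] that(4)[of i] by linarith
    qed
    then have "q0 (\<lambda>i. f i + g i) - c \<le> d"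
      if "v \<in> V" "\<And>i. f i + v i \<le> c" "w \<in> V" "\<And>i. g i + w i \<le> d" for v c w d
      using that by (simp add: diff_le_eq add.commute)
    note * = this
    have **: "q0 (\<lambda>i. f i + g i) - c \<le> q0 g" if vc: "v \<in> V" "\<And>i. f i + v i \<le> c" for v c
    proof (rule ge[OF b(2)])
      fix w d assume "w \<in> V" "\<And>i. g i + w i \<le> d"
      then show "q0 (\<lambda>i. f i + g i) - c \<le> d" using *[OF vc] by blast
    qed
    have "q0 (\<lambda>i. f i + g i) - q0 g \<le> q0 f"
    proof (rule ge[OF b(1)])
      fix v c assume "v \<in> V" "\<And>i. f i + v i \<le> c"
      from **[OF this] show "q0 (\<lambda>i. f i + g i) - q0 g \<le> c" by simp
    qed
    then show "q0 (\<lambda>i. f i + g i) \<le> q0 f + q0 g" by simp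
  next
    fix f :: "'i \<Rightarrow> real" and c :: real assume b: "bounded (range f)" "0 < c"
    have "q0 (\<lambda>i. c * f i) \<le> c * d" if "v \<in> V" "\<And>i. f i + v i \<le> d" for v d
    proof (rule le[OF bounded_range_cmult[OF b(1)] cmult[OF that(1), of c]])
      fix i show "c * f i + c * v i \<le> c * d"
        using that(2)[of i] b(2) by (simp flip: distrib_left)
    qed
    note * = this
    have "q0 (\<lambda>i. c * f i) / c \<le> q0 f"
    proof (rule ge[OF b(1)])
      fix v d assume "v \<in> V" "\<And>i. f i + v i \<le> d"
      from *[OF this] show "q0 (\<lambda>i. c * f i) / c \<le> d" using b(2) by (simp add: field_simps)
    qed
    then show "q0 (\<lambda>i. c * f i) \<le> c * q0 f" using b(2) by (simp add: field_simps)
  qed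
  from hahn_banach_bounded[OF this] obtain L where
    L': "sublinear L" "\<forall>f. bounded (range f) \<longrightarrow> L f \<le> q0 f"
      "\<forall>f. bounded (range f) \<longrightarrow> L (\<lambda>i. - f i) = - L f" by (elim exE conjE) (rule that)
  note L = L'(1) L'(2)[rule_format] L'(3)[rule_format]
  have zero: "(\<lambda>i. 0 * v i) \<in> V" if "v \<in> V" for v by (rule cmult[OF that])
  obtain v0 where v0: "v0 \<in> V" using ne by blast
  have Lle: "L f \<le> c" if "bounded (range f)" "\<And>i. f i \<le> c" for f c
  proof -
    have "q0 f \<le> c" by (rule le[OF that(1) zero[OF v0]]) (simp add: that(2))
    with L(2)[OF that(1)] show ?thesis by linarith
  qed
  have Ladd: "L (\<lambda>i. f i + g i) = L f + L g" if b: "bounded (range f)" "bounded (range g)" for f g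
  proof -
    \<comment> \<open>Oddness turns subadditivity at the negated functions into
      superadditivity.\<close>
    have "L (\<lambda>i. - f i + - g i) \<le> L (\<lambda>i. - f i) + L (\<lambda>i. - g i)"
      by (rule sublinear_add[OF L(1)]) (use b in \<open>auto intro: bounded_range_minus\<close>)
    moreover have "L (\<lambda>i. - f i + - g i) = - L (\<lambda>i. f i + g i)"
      using L(3)[OF bounded_range_add[OF b]] by simp
    ultimately show ?thesis using sublinear_add[OF L(1) b] L(3) b by simp
  qed
  have Lcm: "L (\<lambda>i. c * f i) = c * L f" if b: "bounded (range f)" for f c
  proof (cases "0 \<le> c")
    case True
    then show ?thesis by (rule sublinear_cmult[OF L(1) b])
  next
    case False
    then have "L (\<lambda>i. (- c) * f i) = (- c) * L f" by (intro sublinear_cmult[OF L(1) b]) simp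
    then show ?thesis using L(3)[OF bounded_range_cmult[OF b, of c]] by simp
  qed
  have "0 \<le> L f" if "bounded (range f)" "\<forall>i. 0 \<le> f i" for f
    using Lle[OF bounded_range_minus[OF that(1)], of 0] L(3)[OF that(1)] that(2) by simp
  moreover have "L (\<lambda>_. 1) = 1"
    using Lle[OF bounded_range_const[of 1], of 1] Lle[OF bounded_range_const[of "-1"], of "-1"]
      L(3)[OF bounded_range_const[of 1]] by simp
  ultimately have "mean L" using Ladd Lcm by (auto simp: mean_def)
  moreover have "L v = 0" if v: "v \<in> V" for v
  proof -
    \<comment> \<open>Shifting \<open>w\<close> by the member \<open>- w\<close> of \<open>V\<close>
      gives \<open>q0 w \<le> 0\<close>.\<close>
    have "L w \<le> 0" if w: "w \<in> V" for w
      using L(2)[OF bdd[OF w]] le[OF bdd[OF w] cmult[OF w, of "-1"], of 0] by simp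
    from this[OF v] this[OF cmult[OF v, of "-1"]] show ?thesis
      using L(3)[OF bdd[OF v]] by simp
  qed
  ultimately show ?thesis by blast
qed

section \<open>Linearity, monotonicity and null functions of a mean\<close>

lemma mean_add:
  "mean L \<Longrightarrow> bounded (range f) \<Longrightarrow> bounded (range g) \<Longrightarrow> L (\<lambda>i. f i + g i) = L f + L g"
  by (simp add: mean_def)

lemma mean_cmult: "mean L \<Longrightarrow> bounded (range f) \<Longrightarrow> L (\<lambda>i. c * f i) = c * L f"
  by (simp add: mean_def)

lemma mean_nonneg: "mean L \<Longrightarrow> bounded (range f) \<Longrightarrow> (\<And>i. 0 \<le> f i) \<Longrightarrow> 0 \<le> L f"
  by (simp add: mean_def)

lemma mean_const: "mean L \<Longrightarrow> L (\<lambda>_. c) = c"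
  using mean_cmult[OF _ bounded_range_const[of 1], of L c] by (simp add: mean_def)

lemma mean_diff:
  assumes "mean L" "bounded (range f)" "bounded (range g)"
  shows "L (\<lambda>i. f i - g i) = L f - L g"
  using mean_add[OF assms(1) bounded_range_diff[OF assms(2,3)] assms(3)] by simp

lemma mean_mono:
  assumes "mean L" "bounded (range f)" "bounded (range g)" "\<And>i. f i \<le> g i"
  shows "L f \<le> L g"
  using mean_nonneg[OF assms(1) bounded_range_diff[OF assms(3,2)]] mean_diff[OF assms(1,3,2)] assms(4)
  by simp

lemma mean_abs_le:
  assumes "mean L" "bounded (range f)" "\<And>i. \<bar>f i\<bar> \<le> c"
  shows "\<bar>L f\<bar> \<le> c"
proof -
  have le: "f i \<le> c" "- c \<le> f i" for i using assms(3)[of i] by linarith+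
  have "L f \<le> c"
    using mean_mono[OF assms(1,2) bounded_range_const le(1)] mean_const[OF assms(1)] by simp
  moreover have "- c \<le> L f"
    using mean_mono[OF assms(1) bounded_range_const assms(2) le(2)] mean_const[OF assms(1)] by simp
  ultimately show ?thesis by linarith
qed

lemma mean_sum:
  assumes "mean L" "finite K" "\<And>k. k \<in> K \<Longrightarrow> bounded (range (f k))"
  shows "L (\<lambda>i. \<Sum>k\<in>K. f k i) = (\<Sum>k\<in>K. L (f k))"
  using assms(2,3)
proof (induction K rule: finite_induct)
  case empty
  then show ?case using mean_const[OF assms(1)] by simp
next
  case (insert k K)
  have "L (\<lambda>i. f k i + (\<Sum>k\<in>K. f k i)) = L (f k) + L (\<lambda>i. \<Sum>k\<in>K. f k i)"
    by (intro mean_add[OF assms(1)] bounded_range_sum) (use insert.prems in auto)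
  then show ?case using insert by simp
qed

text \<open>A Chebyshev estimate: \<bar>g\<bar> is at most \<open>e + B / \<delta> * z\<close>
  pointwise, where \<open>B\<close> bounds \<bar>g\<bar>. For a merely finitely additive charge a
  null integral of \<open>z\<close> does not make \<open>z\<close> vanish outside a null set, so
  \<open>g\<close> is asked to be small uniformly wherever \<open>z\<close> is small. This is the
  tool for all independence of representatives below.\<close>

lemma mean_eq_0I:
  fixes g z :: "'i \<Rightarrow> real"
  assumes L: "mean L" and z: "bounded (range z)" "\<And>i. 0 \<le> z i" "L z = 0"
    and g: "bounded (range g)"
    and small: "\<And>e. 0 < e \<Longrightarrow> \<exists>\<delta>>0. \<forall>i. z i < \<delta> \<longrightarrow> \<bar>g i\<bar> \<le> e"
  shows "L g = 0"
proof -
  have "\<bar>L g\<bar> \<le> e" if e: "0 < e" for e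
  proof -
    obtain \<delta> where \<delta>': "\<delta> > 0" "\<forall>i. z i < \<delta> \<longrightarrow> \<bar>g i\<bar> \<le> e"
      using small[OF e] by (elim exE conjE)
    note \<delta> = \<delta>'(1) \<delta>'(2)[rule_format]
    obtain B where B: "\<And>i. \<bar>g i\<bar> \<le> B" using g by (auto simp: bounded_range_iff)
    have B0: "0 \<le> B" using B[of undefined] by linarith
    define h where "h = (\<lambda>i. e + B / \<delta> * z i)"
    have h: "bounded (range h)" unfolding h_def by (rule bounded_range_add[OF bounded_range_const bounded_range_cmult[OF z(1)]])
    have "L h = L (\<lambda>i. e) + L (\<lambda>i. B / \<delta> * z i)"
      unfolding h_def by (rule mean_add[OF L bounded_range_const bounded_range_cmult[OF z(1)]])
    then have Lh: "L h = e" by (simp only: mean_cmult[OF L z(1)] mean_const[OF L] z(3))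
    have gh: "\<bar>g i\<bar> \<le> h i" for i
    proof (cases "z i < \<delta>")
      case True
      then have "\<bar>g i\<bar> \<le> e" by (rule \<delta>(2))
      moreover have "0 \<le> B / \<delta> * z i" using B0 \<delta>(1) z(2)[of i] by simp
      ultimately show ?thesis by (simp add: h_def)
    next
      case False
      then have "B / \<delta> * \<delta> \<le> B / \<delta> * z i"
        using B0 \<delta>(1) by (intro mult_left_mono) auto
      then have "B \<le> B / \<delta> * z i" using \<delta>(1) by simp
      then show ?thesis using B[of i] e by (simp add: h_def)
    qed
    have *: "g i \<le> h i" "- h i \<le> g i" for i using gh[of i] by linarith+
    have "L g \<le> L h" by (rule mean_mono[OF L g h *(1)])
    moreover have "L (\<lambda>i. - h i) \<le> L g" by (rule mean_mono[OF L bounded_range_minus[OF h] g *(2)])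
    moreover have "L (\<lambda>i. - h i) = - L h" using mean_cmult[OF L h, of "-1"] by simp
    ultimately show ?thesis using Lh by linarith
  qed
  then have "\<bar>L g\<bar> \<le> 0 + e" if "0 < e" for e using that by simp
  then have "\<bar>L g\<bar> \<le> 0" by (rule field_le_epsilon)
  then show ?thesis by simp
qed

section \<open>The charge integral computed by a mean\<close>

lemma simple_charge_integral_eq_mean:
  assumes L: "mean L" and s: "finite (range s)"
  shows "simple_charge_integral UNIV (\<lambda>X. L (indicator X)) s = L s"
proof -
  have ind: "bounded (range (indicator X :: _ \<Rightarrow> real))" for X
    by (auto simp: bounded_range_iff indicator_def)
  have "s = (\<lambda>i. \<Sum>c\<in>range s. c * indicator (s -` {c}) i)"
  proof (rule ext)
    fix i
    have "(\<Sum>c\<in>range s. c * indicator (s -` {c}) i) = (\<Sum>c\<in>range s. if s i = c then c else 0)"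
      by (rule sum.cong) (auto simp: indicator_def)
    also have "\<dots> = s i" using s by simp
    finally show "s i = (\<Sum>c\<in>range s. c * indicator (s -` {c}) i)" ..
  qed
  then have "L s = L (\<lambda>i. \<Sum>c\<in>range s. c * indicator (s -` {c}) i)" by (rule arg_cong)
  also have "\<dots> = (\<Sum>c\<in>range s. L (\<lambda>i. c * indicator (s -` {c}) i))"
    by (rule mean_sum[OF L s]) (intro bounded_range_cmult ind)
  also have "\<dots> = (\<Sum>c\<in>range s. c * L (indicator (s -` {c})))"
    by (simp add: mean_cmult[OF L ind])
  finally show ?thesis by (simp add: simple_charge_integral_def)
qed

text \<open>A mean differs on two functions by at most their uniform distance, so every
  approximating sequence has the limit \<open>L f\<close>; this gives the uniqueness demanded by
  \<open>THE\<close>. Existence comes from rounding \<open>f\<close>.\<close>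

lemma charge_integral_eq_mean:
  fixes f :: "'i \<Rightarrow> real"
  assumes L: "mean L" and f: "bounded (range f)" and meas: "\<And>X. f -` X \<in> \<A>"
  shows "charge_integral UNIV \<A> (\<lambda>X. L (indicator X)) f = L f"
proof -
  obtain B where B: "\<And>i. \<bar>f i\<bar> \<le> B" using f by (auto simp: bounded_range_iff)
  have lim: "(\<lambda>n. simple_charge_integral UNIV (\<lambda>X. L (indicator X)) (s n)) \<longlonglongrightarrow> L f"
    if s: "\<And>n. simple_on UNIV \<A> (s n)" "uniform_limit UNIV s f sequentially" for s
  proof (rule LIMSEQ_I)
    fix e :: real assume "0 < e"
    then have "0 < e/2" by simp
    with s(2) have "\<forall>\<^sub>F n in sequentially. \<forall>i\<in>UNIV. dist (s n i) (f i) < e/2"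
      unfolding uniform_limit_iff by blast
    then obtain n0 where n0: "\<And>n i. n0 \<le> n \<Longrightarrow> \<bar>s n i - f i\<bar> < e/2"
      by (auto simp: eventually_sequentially dist_real_def)
    have "norm (simple_charge_integral UNIV (\<lambda>X. L (indicator X)) (s n) - L f) < e" if "n0 \<le> n" for n
    proof -
      have fin: "finite (range (s n))" using s(1)[of n] by (simp add: simple_on_def)
      then have b: "bounded (range (s n))" by (rule finite_imp_bounded)
      have "\<bar>L (\<lambda>i. s n i - f i)\<bar> \<le> e/2"
        by (rule mean_abs_le[OF L bounded_range_diff[OF b f]]) (use n0[OF that] in \<open>simp add: less_imp_le\<close>)
      then show ?thesis
        using simple_charge_integral_eq_mean[OF L fin] mean_diff[OF L b f] \<open>0 < e\<close> by simp
    qed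
    then show "\<exists>n0. \<forall>n\<ge>n0. norm (simple_charge_integral UNIV (\<lambda>X. L (indicator X)) (s n) - L f) < e"
      by blast
  qed
  \<comment> \<open>Rounding down to multiples of \<open>1 / Suc n\<close>: boundedness of
    \<open>f\<close> leaves finitely many values, and the error is below
    \<open>1 / Suc n\<close>.\<close>
  define s where "s = (\<lambda>n i. real_of_int \<lfloor>real (Suc n) * f i\<rfloor> / real (Suc n))"
  have simple: "simple_on UNIV \<A> (s n)" for n
    unfolding simple_on_def
  proof (intro conjI allI)
    have "real_of_int \<lfloor>real (Suc n) * f i\<rfloor> / real (Suc n)
        \<in> (\<lambda>k. real_of_int k / real (Suc n)) ` {\<lfloor>real (Suc n) * - B\<rfloor>..\<lfloor>real (Suc n) * B\<rfloor>}" for i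
    proof (rule imageI)
      have "- B \<le> f i" "f i \<le> B" using B[of i] by linarith+
      then have "real (Suc n) * - B \<le> real (Suc n) * f i" "real (Suc n) * f i \<le> real (Suc n) * B"
        by (simp_all only: mult_le_cancel_left_pos of_nat_0_less_iff zero_less_Suc)
      then have "\<lfloor>real (Suc n) * - B\<rfloor> \<le> \<lfloor>real (Suc n) * f i\<rfloor>"
        "\<lfloor>real (Suc n) * f i\<rfloor> \<le> \<lfloor>real (Suc n) * B\<rfloor>"
        by (simp_all only: floor_mono)
      then show "\<lfloor>real (Suc n) * f i\<rfloor> \<in> {\<lfloor>real (Suc n) * - B\<rfloor>..\<lfloor>real (Suc n) * B\<rfloor>}"
        unfolding atLeastAtMost_iff by blast
    qed
    then have "range (s n) \<subseteq>
        (\<lambda>k. real_of_int k / real (Suc n)) ` {\<lfloor>real (Suc n) * - B\<rfloor>..\<lfloor>real (Suc n) * B\<rfloor>}"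
      unfolding s_def by blast
    then show "finite (range (s n))" by (rule finite_subset) simp
  next
    fix c
    have "s n -` {c} \<inter> UNIV = f -` {x. real_of_int \<lfloor>real (Suc n) * x\<rfloor> / real (Suc n) = c}"
      by (auto simp: s_def)
    then show "s n -` {c} \<inter> UNIV \<in> \<A>" using meas by metis
  qed
  have unif: "uniform_limit UNIV s f sequentially"
  proof (rule uniform_limitI)
    fix e :: real assume "0 < e"
    then obtain n0 where n0: "inverse (real (Suc n0)) < e" using reals_Archimedean by blast
    have "dist (s n i) (f i) < e" if "n0 \<le> n" for n i
    proof -
      have "\<bar>real_of_int \<lfloor>real (Suc n) * f i\<rfloor> - real (Suc n) * f i\<bar> < 1" by linarith
      moreover have "s n i - f i = (real_of_int \<lfloor>real (Suc n) * f i\<rfloor> - real (Suc n) * f i) / real (Suc n)"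
        by (simp add: s_def diff_divide_distrib del: of_nat_Suc)
      ultimately have "\<bar>s n i - f i\<bar> < inverse (real (Suc n))"
        by (simp only: abs_divide) (simp add: divide_simps del: of_nat_Suc)
      also have "\<dots> \<le> inverse (real (Suc n0))" using that by simp
      finally show ?thesis using n0 by (simp add: dist_real_def)
    qed
    then show "\<forall>\<^sub>F n in sequentially. \<forall>i\<in>UNIV. dist (s n i) (f i) < e"
      by (auto simp: eventually_sequentially)
  qed
  show ?thesis
    unfolding charge_integral_def
  proof (rule the_equality)
    show "\<exists>s. (\<forall>n. simple_on UNIV \<A> (s n)) \<and> uniform_limit UNIV s f sequentially \<and>
        (\<lambda>n. simple_charge_integral UNIV (\<lambda>X. L (indicator X)) (s n)) \<longlonglongrightarrow> L f"
      by (intro exI[of _ s] conjI allI simple unif lim)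
  next
    fix l assume "\<exists>s. (\<forall>n. simple_on UNIV \<A> (s n)) \<and> uniform_limit UNIV s f sequentially \<and>
        (\<lambda>n. simple_charge_integral UNIV (\<lambda>X. L (indicator X)) (s n)) \<longlonglongrightarrow> l"
    then obtain s' where s': "\<forall>n. simple_on UNIV \<A> (s' n)" "uniform_limit UNIV s' f sequentially"
      and l: "(\<lambda>n. simple_charge_integral UNIV (\<lambda>X. L (indicator X)) (s' n)) \<longlonglongrightarrow> l" by (elim exE conjE)
    from l lim[OF s'(1)[rule_format] s'(2)] show "l = L f" by (rule LIMSEQ_unique)
  qed
qed

section \<open>Integrals over equivalent tuples of maps\<close>

lemma abs_powr_diff_small:
  fixes p :: real
  assumes "1 \<le> p" "0 < e"
  shows "\<exists>\<delta>>0. \<forall>x\<in>{0..1}. \<forall>y\<in>{0..1}. \<bar>x - y\<bar> < \<delta> \<longrightarrow> \<bar>x powr p - y powr p\<bar> < e"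
proof -
  have "continuous_on {0..1::real} (\<lambda>x. x powr p)"
    using assms(1) by (intro continuous_on_powr' continuous_intros) auto
  then have "uniformly_continuous_on {0..1::real} (\<lambda>x. x powr p)"
    by (rule compact_uniformly_continuous) simp
  then show ?thesis
    using assms(2) unfolding uniformly_continuous_on_def dist_real_def by blast
qed

text \<open>Here \<open>z\<close> stands for the sum of \<open>p\<close>-th powers inside a tuple
  distance. That sum, rather than its root, is what a mean integrates to 0.\<close>

lemma modulus_small:
  fixes p :: real
  assumes "modulus l" "1 \<le> p" "0 < e"
  shows "\<exists>\<delta>>0. \<forall>z. 0 \<le> z \<longrightarrow> z < \<delta> \<longrightarrow> l (z powr (1 / p)) < e"
proof -
  have "continuous_on {0..} l" "l 0 = 0" using assms(1) by (auto simp: modulus_def)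
  moreover from this(1) assms(3) have "\<exists>d>0. \<forall>x\<in>{0::real..}. dist x 0 < d \<longrightarrow> dist (l x) (l 0) < e"
    unfolding continuous_on_iff by (metis atLeast_iff order_refl)
  ultimately obtain d where d: "d > 0" "\<And>x. 0 \<le> x \<Longrightarrow> x < d \<Longrightarrow> \<bar>l x\<bar> < e"
    by (auto simp: dist_real_def)
  have "l (z powr (1 / p)) < e" if z: "0 \<le> z" "z < d powr p" for z
  proof -
    have "z powr (1 / p) < (d powr p) powr (1 / p)"
      using z assms(2) by (intro powr_less_mono2) auto
    also have "\<dots> = d" using d(1) assms(2) by (simp add: powr_powr)
    finally show ?thesis using d(2)[of "z powr (1/p)"] z(1) by auto
  qed
  then show ?thesis using d(1) by (intro exI[of _ "d powr p"]) auto
qed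

section \<open>Cardinalities of types\<close>

lemma type_ordLeqI: "inj f \<Longrightarrow> |UNIV :: 'x set| \<le>o |UNIV :: 'y set|" for f :: "'x \<Rightarrow> 'y"
  by (auto intro: card_of_ordLeqI)

lemma type_ordLeqE:
  assumes "|UNIV :: 'x set| \<le>o |UNIV :: 'y set|"
  obtains f :: "'x \<Rightarrow> 'y" where "inj f"
  using assms by (auto simp flip: card_of_ordLeq)

lemma set_ordLeq_set:
  assumes "|UNIV :: 'x set| \<le>o |UNIV :: 'y set|"
  shows "|UNIV :: 'x set set| \<le>o |UNIV :: 'y set set|"
proof -
  obtain f :: "'x \<Rightarrow> 'y" where "inj f" using assms by (rule type_ordLeqE)
  then have "inj (image f)" by (simp add: inj_image_eq_iff inj_def)
  then show ?thesis by (rule type_ordLeqI)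
qed

lemma ordLeq_set: "|UNIV :: 'x set| \<le>o |UNIV :: 'x set set|"
  by (rule type_ordLeqI[of "\<lambda>x. {x}"]) (simp add: inj_def)

lemma finite_type_ordLeq:
  assumes "finite (UNIV :: 'x set)" "infinite (UNIV :: 'z set)"
  shows "|UNIV :: 'x set| \<le>o |UNIV :: 'z set|"
  using ordLess_imp_ordLeq[OF finite_ordLess_infinite[OF card_of_Well_order card_of_Well_order]] assms
  by (metis Field_card_of)

lemma prod_ordLeq:
  assumes "infinite (UNIV :: 'z set)"
    and "|UNIV :: 'x set| \<le>o |UNIV :: 'z set|" "|UNIV :: 'y set| \<le>o |UNIV :: 'z set|"
  shows "|UNIV :: ('x \<times> 'y) set| \<le>o |UNIV :: 'z set|"
proof -
  obtain h :: "'z \<times> 'z \<Rightarrow> 'z" where h: "inj h"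
    using card_of_Times_same_infinite[OF assms(1)]
    by (auto dest!: ordIso_imp_ordLeq elim!: type_ordLeqE)
  obtain f :: "'x \<Rightarrow> 'z" where f: "inj f" using assms(2) by (rule type_ordLeqE)
  obtain g :: "'y \<Rightarrow> 'z" where g: "inj g" using assms(3) by (rule type_ordLeqE)
  have "inj (h \<circ> map_prod f g)" by (rule inj_compose[OF h prod.inj_map[OF f g]])
  then show ?thesis by (rule type_ordLeqI)
qed

lemma sum_ordLeq:
  assumes "infinite (UNIV :: 'z set)"
    and "|UNIV :: 'x set| \<le>o |UNIV :: 'z set|" "|UNIV :: 'y set| \<le>o |UNIV :: 'z set|"
  shows "|UNIV :: ('x + 'y) set| \<le>o |UNIV :: 'z set|"
proof -
  have "|UNIV :: bool set| \<le>o |UNIV :: 'z set|"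
    using assms(1) by (intro finite_type_ordLeq) auto
  then have *: "|UNIV :: (bool \<times> 'z) set| \<le>o |UNIV :: 'z set|"
    by (rule prod_ordLeq[OF assms(1)]) (rule ordLeq_refl[OF card_of_Card_order])
  obtain f :: "'x \<Rightarrow> 'z" where f: "inj f" using assms(2) by (rule type_ordLeqE)
  obtain g :: "'y \<Rightarrow> 'z" where g: "inj g" using assms(3) by (rule type_ordLeqE)
  have "inj (case_sum (\<lambda>x. (True, f x)) (\<lambda>y. (False, g y)))"
    using f g by (auto simp: inj_def split: sum.splits)
  then have "|UNIV :: ('x + 'y) set| \<le>o |UNIV :: (bool \<times> 'z) set|"
    by (rule type_ordLeqI)
  then show ?thesis using * by (rule ordLeq_transitive)
qed

lemma option_ordLeq:
  assumes "infinite (UNIV :: 'z set)" and "|UNIV :: 'x set| \<le>o |UNIV :: 'z set|"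
  shows "|UNIV :: 'x option set| \<le>o |UNIV :: 'z set|"
proof -
  have "|UNIV :: unit set| \<le>o |UNIV :: 'z set|"
    using assms(1) by (intro finite_type_ordLeq) auto
  then have *: "|UNIV :: (unit + 'x) set| \<le>o |UNIV :: 'z set|"
    by (rule sum_ordLeq[OF assms(1) _ assms(2)])
  have "inj (case_option (Inl ()) Inr :: 'x option \<Rightarrow> unit + 'x)"
    by (auto simp: inj_def split: option.splits)
  then have "|UNIV :: 'x option set| \<le>o |UNIV :: (unit + 'x) set|"
    by (rule type_ordLeqI)
  then show ?thesis using * by (rule ordLeq_transitive)
qed

text \<open>A function is coded by its graph. In these bounds \<open>|UNIV :: 'z set set|\<close> is
  the cardinality of the type \<open>'z set\<close>, so each further \<open>set\<close> stands for
  one exponentiation.\<close>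

lemma fun_ordLeq_set:
  assumes "infinite (UNIV :: 'z set)"
    and "|UNIV :: 'x set| \<le>o |UNIV :: 'z set|" "|UNIV :: 'y set| \<le>o |UNIV :: 'z set|"
  shows "|UNIV :: ('x \<Rightarrow> 'y) set| \<le>o |UNIV :: 'z set set|"
proof -
  have "inj (\<lambda>f :: 'x \<Rightarrow> 'y. {(x, f x) |x. True})"
    by (rule injI, rule ext) blast
  then have "|UNIV :: ('x \<Rightarrow> 'y) set| \<le>o |UNIV :: ('x \<times> 'y) set set|" by (rule type_ordLeqI)
  then show ?thesis using set_ordLeq_set[OF prod_ordLeq[OF assms]] by (rule ordLeq_transitive)
qed

lemma nat_ordLeq: "infinite (UNIV :: 'z set) \<Longrightarrow> |UNIV :: nat set| \<le>o |UNIV :: 'z set|"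
  by (simp add: infinite_iff_card_of_nat)

text \<open>Lists are read as partial functions on \<open>nat\<close>. The bound is generous by one
  power set, which the size of \<open>index\<close> allows.\<close>

lemma list_ordLeq_set:
  assumes "infinite (UNIV :: 'z set)" and "|UNIV :: 'x set| \<le>o |UNIV :: 'z set|"
  shows "|UNIV :: 'x list set| \<le>o |UNIV :: 'z set set|"
proof -
  have "inj (\<lambda>(xs :: 'x list) n. if n < length xs then Some (xs ! n) else None)"
  proof (rule injI)
    fix xs ys :: "'x list"
    assume "(\<lambda>n. if n < length xs then Some (xs ! n) else None) =
      (\<lambda>n. if n < length ys then Some (ys ! n) else None)"
    then have *: "(if n < length xs then Some (xs ! n) else None) =
      (if n < length ys then Some (ys ! n) else None)" for n by (rule fun_cong)
    have "n < length xs \<longleftrightarrow> n < length ys" for n using *[of n] by (auto split: if_splits)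
    then have len: "length xs = length ys" by (meson linorder_neqE_nat less_irrefl)
    show "xs = ys"
      by (rule nth_equalityI[OF len]) (metis * len option.inject)
  qed
  then have "|UNIV :: 'x list set| \<le>o |UNIV :: (nat \<Rightarrow> 'x option) set|" by (rule type_ordLeqI)
  then show ?thesis
    using fun_ordLeq_set[OF assms(1) nat_ordLeq[OF assms(1)] option_ordLeq[OF assms]]
    by (rule ordLeq_transitive)
qed

lemma infinite_set_type: "infinite (UNIV :: 'z set) \<Longrightarrow> infinite (UNIV :: 'z set set)"
  by (simp add: Finite_Set.finite_set)

section \<open>Well-founded coordinates\<close>

text \<open>The coordinates of the product of copies of \<open>M \<times> N\<close> are trees. The label of a node is a map
  that expresses one component of the coordinate through the coordinates below it, so that
  every map depending on few coordinates occurs as a component of some coordinate.\<close>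

datatype ('u, 'l) tree = Leaf | Node 'l "'u \<Rightarrow> ('u, 'l) tree"

text \<open>The label found at the end of a path from the root, or \<open>None\<close> if the path
  reaches a \<open>Leaf\<close>. It turns a tree into a function on lists, and such functions can be
  counted.\<close>

primrec labels :: "('u, 'l) tree \<Rightarrow> 'u list \<Rightarrow> 'l option" where
  "labels Leaf = (\<lambda>us. None)"
| "labels (Node l c) = (\<lambda>us. case us of [] \<Rightarrow> Some l | v # vs \<Rightarrow> labels (c v) vs)"

lemma inj_labels: "inj labels"
proof (rule injI)
  fix s t :: "('u, 'l) tree"
  show "labels s = labels t \<Longrightarrow> s = t"
  proof (induction s arbitrary: t)
    case Leaf
    then have "labels t [] = None" by (metis labels.simps(1))
    then show ?case by (cases t) auto
  next
    case (Node l c)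
    have lab: "labels (Node l c) us = labels t us" for us using Node.prems by (rule fun_cong)
    obtain l' c' where t: "t = Node l' c'" using lab[of "[]"] by (cases t) auto
    have "labels (c v) = labels (c' v)" for v
    proof (rule ext)
      fix vs show "labels (c v) vs = labels (c' v) vs" using lab[of "v # vs"] t by simp
    qed
    then have "c v = c' v" for v by (intro Node.IH) auto
    then show ?case using lab[of "[]"] t by auto
  qed
qed

lemma tree_ordLeq:
  assumes "infinite (UNIV :: 'z set)"
    and "|UNIV :: 'u set| \<le>o |UNIV :: 'z set|" "|UNIV :: 'l set| \<le>o |UNIV :: 'z set set|"
  shows "|UNIV :: ('u, 'l) tree set| \<le>o |UNIV :: 'z set set set|"
proof -
  note inf = infinite_set_type[OF assms(1)]
  have "|UNIV :: ('u, 'l) tree set| \<le>o |UNIV :: ('u list \<Rightarrow> 'l option) set|"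
    by (rule type_ordLeqI[OF inj_labels])
  then show ?thesis
    using fun_ordLeq_set[OF inf list_ordLeq_set[OF assms(1,2)] option_ordLeq[OF inf assms(3)]]
    by (rule ordLeq_transitive)
qed

definition child :: "(('u, 'l) tree \<times> ('u, 'l) tree) set" where
  "child = {(c v, Node l c) |l c v. True}"

text \<open>Used twice: among finitely many coordinates some one is no child of another, and no
  coordinate is a child of itself.\<close>

lemma wf_child: "wf child"
proof (rule wfUNIVI)
  fix P :: "('u, 'l) tree \<Rightarrow> bool" and t
  assume *: "\<forall>t. (\<forall>s. (s, t) \<in> child \<longrightarrow> P s) \<longrightarrow> P t"
  show "P t"
  proof (induction t)
    case Leaf
    show ?case using * by (auto simp: child_def)
  next
    case (Node l c)
    show ?case
    proof (rule *[rule_format])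
      fix s assume "(s, Node l c) \<in> child"
      then obtain v where "s = c v" by (auto simp: child_def)
      then show "P s" using Node by auto
    qed
  qed
qed

text \<open>The measure of "few": an infinite type into which both \<open>'a\<close> and
  \<open>'b\<close> embed.\<close>

type_synonym ('a, 'b) base = "nat + 'a + 'b"
text \<open>A label reads the raw values in \<open>'a \<times> 'b\<close> at the children, not their
  two components. A change of the raw value at one coordinate therefore reaches its parents but no
  higher ancestors.\<close>

type_synonym ('a, 'b) coord =
  "(('a, 'b) base, ((('a, 'b) base \<Rightarrow> 'a \<times> 'b) \<Rightarrow> 'a) + ((('a, 'b) base \<Rightarrow> 'a \<times> 'b) \<Rightarrow> 'b)) tree"

lemma infinite_base: "infinite (UNIV :: ('a, 'b) base set)"
  by simp

lemma left_ordLeq_base: "|UNIV :: 'a set| \<le>o |UNIV :: ('a, 'b) base set|"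
  by (rule type_ordLeqI[of "\<lambda>x. Inr (Inl x)"]) (simp add: inj_def)

lemma right_ordLeq_base: "|UNIV :: 'b set| \<le>o |UNIV :: ('a, 'b) base set|"
  by (rule type_ordLeqI[of "\<lambda>x. Inr (Inr x)"]) (simp add: inj_def)

text \<open>Labels are bounded by two exponentials over \<open>base\<close>, trees by three, and
  functions on trees by four, which are the four power sets in \<open>index\<close>.\<close>

lemma coord_fun_ordLeq_index:
  "|UNIV :: (('a, 'b) coord \<Rightarrow> 'a \<times> 'b) set| \<le>o |UNIV :: ('a, 'b) index set|"
proof -
  note inf = infinite_base[where 'a = 'a and 'b = 'b]
  note l = left_ordLeq_base[where 'a = 'a and 'b = 'b]
    and r = right_ordLeq_base[where 'a = 'a and 'b = 'b]
  note inf1 = infinite_set_type[OF inf]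
  note inf2 = infinite_set_type[OF inf1]
  note inf3 = infinite_set_type[OF inf2]
  have ab: "|UNIV :: ('a \<times> 'b) set| \<le>o |UNIV :: ('a, 'b) base set|"
    by (rule prod_ordLeq[OF inf l r])
  have fn: "|UNIV :: (('a, 'b) base \<Rightarrow> 'a \<times> 'b) set| \<le>o |UNIV :: ('a, 'b) base set set|"
    by (rule fun_ordLeq_set[OF inf _ ab]) (rule ordLeq_refl[OF card_of_Card_order])
  note label = sum_ordLeq[OF inf2 fun_ordLeq_set[OF inf1 fn ordLeq_transitive[OF l ordLeq_set]]
      fun_ordLeq_set[OF inf1 fn ordLeq_transitive[OF r ordLeq_set]]]
  note tree = tree_ordLeq[OF inf1 ordLeq_set label]
  show ?thesis
    by (rule fun_ordLeq_set[OF inf3 tree]) (rule ordLeq_transitive[OF ab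
        ordLeq_transitive[OF ordLeq_set ordLeq_transitive[OF ordLeq_set ordLeq_set]]])
qed

text \<open>The product of copies of \<open>X\<close> is parametrized, possibly with repetitions, by
  the whole index type, so that the charge space can live on \<open>UNIV\<close>. Entries falling
  outside \<open>X\<close> are replaced by a default point.\<close>

lemma projections_exist:
  fixes X :: "('a \<times> 'b) set"
  assumes "X \<noteq> {}"
  shows "\<exists>pr :: ('a, 'b) index \<Rightarrow> ('a, 'b) coord \<Rightarrow> 'a \<times> 'b. range pr = {w. \<forall>t. w t \<in> X}"
proof -
  obtain f :: "(('a, 'b) coord \<Rightarrow> 'a \<times> 'b) \<Rightarrow> ('a, 'b) index" where f: "inj f"
    using coord_fun_ordLeq_index by (rule type_ordLeqE)
  obtain x where x: "x \<in> X" using assms by blast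
  define pr where "pr = (\<lambda>i t. if inv f i t \<in> X then inv f i t else x)"
  have "pr i t \<in> X" for i t using x by (simp add: pr_def)
  moreover have "w \<in> range pr" if "\<forall>t. w t \<in> X" for w
    by (rule range_eqI[of _ _ "f w"]) (use that f in \<open>simp add: pr_def fun_eq_iff\<close>)
  ultimately show ?thesis by blast
qed

lemma base_pairing_exists: "\<exists>\<pi> :: ('a, 'b) base \<Rightarrow> ('a, 'b) base \<times> ('a, 'b) base. surj \<pi>"
proof -
  obtain f :: "('a, 'b) base \<times> ('a, 'b) base \<Rightarrow> ('a, 'b) base" where f: "inj f"
    by (rule type_ordLeqE[OF prod_ordLeq[OF infinite_base ordLeq_refl ordLeq_refl]])
      (rule card_of_Card_order)+
  show ?thesis using inj_imp_surj_inv[OF f] by blast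
qed

section \<open>Values of formulas\<close>

lemma structure_onD:
  assumes "structure_on p \<tau> M"
  shows "Metric_space (str_carrier M) (str_dist M)"
    and "str_carrier M \<noteq> {}"
    and "x \<in> str_carrier M \<Longrightarrow> y \<in> str_carrier M \<Longrightarrow> str_dist M x y \<le> 1"
    and "c \<in> sig_consts \<tau> \<Longrightarrow> str_const M c \<in> str_carrier M"
    and "F \<in> sig_funs \<tau> \<Longrightarrow> xs \<in> tuples (str_carrier M) (fun_arity \<tau> F) \<Longrightarrow>
      str_fun M F xs \<in> str_carrier M"
    and "F \<in> sig_funs \<tau> \<Longrightarrow> xs \<in> tuples (str_carrier M) (fun_arity \<tau> F) \<Longrightarrow>
      ys \<in> tuples (str_carrier M) (fun_arity \<tau> F) \<Longrightarrow>
      str_dist M (str_fun M F xs) (str_fun M F ys)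
        \<le> fun_modulus \<tau> F (tuple_dist p (str_dist M) xs ys)"
    and "R \<in> sig_rels \<tau> \<Longrightarrow> xs \<in> tuples (str_carrier M) (rel_arity \<tau> R) \<Longrightarrow>
      \<bar>str_rel M R xs\<bar> \<le> rel_bound \<tau> R"
    and "R \<in> sig_rels \<tau> \<Longrightarrow> xs \<in> tuples (str_carrier M) (rel_arity \<tau> R) \<Longrightarrow>
      ys \<in> tuples (str_carrier M) (rel_arity \<tau> R) \<Longrightarrow>
      \<bar>str_rel M R xs - str_rel M R ys\<bar> \<le> rel_modulus \<tau> R (tuple_dist p (str_dist M) xs ys)"
  using assms unfolding structure_on_def by simp_all

lemma structure_dist:
  assumes "structure_on p \<tau> M"
  shows "0 \<le> str_dist M x y"
    and "x \<in> str_carrier M \<Longrightarrow> str_dist M x x = 0"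
    and "str_dist M x y = str_dist M y x"
    and "x \<in> str_carrier M \<Longrightarrow> y \<in> str_carrier M \<Longrightarrow> z \<in> str_carrier M \<Longrightarrow>
      str_dist M x z \<le> str_dist M x y + str_dist M y z"
proof -
  interpret Metric_space "str_carrier M" "str_dist M" by (rule structure_onD(1)[OF assms])
  show "0 \<le> str_dist M x y" "x \<in> str_carrier M \<Longrightarrow> str_dist M x x = 0"
    "str_dist M x y = str_dist M y x"
    "x \<in> str_carrier M \<Longrightarrow> y \<in> str_carrier M \<Longrightarrow> z \<in> str_carrier M \<Longrightarrow>
      str_dist M x z \<le> str_dist M x y + str_dist M y z"
    by (auto simp: commute triangle)
qed

lemma structure_dist_powr_le_1:
  assumes "structure_on p \<tau> M" "1 \<le> p" "x \<in> str_carrier M" "y \<in> str_carrier M"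
  shows "str_dist M x y powr p \<le> 1"
  using structure_dist(1)[OF assms(1)] structure_onD(3)[OF assms(1,3,4)] assms(2)
  by (intro powr_le1) auto

lemma trm_val_in_carrier:
  assumes "structure_on p \<tau> M" "\<And>n. s n \<in> str_carrier M"
  shows "wf_trm \<tau> t \<Longrightarrow> trm_val M s t \<in> str_carrier M"
proof (induction t)
  case (App F ts)
  then show ?case
    by (auto simp: tuples_def intro!: structure_onD(5)[OF assms(1)])
qed (use assms structure_onD(4)[OF assms(1)] in auto)

lemma trm_vals_in_tuples:
  assumes "structure_on p \<tau> M" "\<And>n. s n \<in> str_carrier M" "\<forall>t\<in>set ts. wf_trm \<tau> t" "length ts = k"
  shows "map (trm_val M s) ts \<in> tuples (str_carrier M) k"
  using trm_val_in_carrier[OF assms(1,2)] assms(3,4) by (auto simp: tuples_def)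

lemma trm_val_cong: "(\<And>n. n \<in> trm_vars t \<Longrightarrow> s n = s' n) \<Longrightarrow> trm_val M s t = trm_val M s' t"
proof (induction t)
  case (App F ts)
  then have "map (trm_val M s) ts = map (trm_val M s') ts" by auto
  then show ?case by (simp only: trm_val.simps)
qed auto

lemma fm_val_cong:
  "(\<And>n. n \<in> free_vars \<phi> \<Longrightarrow> s n = s' n) \<Longrightarrow> fm_val p M \<phi> s = fm_val p M \<phi> s'"
proof (induction \<phi> arbitrary: s s')
  case (DistP t u)
  then show ?case using trm_val_cong[of t s s' M] trm_val_cong[of u s s' M] by simp
next
  case (Rel R ts)
  have "map (trm_val M s) ts = map (trm_val M s') ts"
    using Rel by (auto intro!: trm_val_cong)
  then show ?case by (simp only: fm_val.simps)
next
  case (Plus \<phi> \<psi>)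
  have "fm_val p M \<phi> s = fm_val p M \<phi> s'" "fm_val p M \<psi> s = fm_val p M \<psi> s'"
    using Plus.prems by (auto intro!: Plus.IH)
  then show ?case by simp
next
  case (SupF n \<phi>)
  have "fm_val p M \<phi> (s(n := x)) = fm_val p M \<phi> (s'(n := x))" for x
    using SupF.prems by (intro SupF.IH) auto
  then show ?case by simp
next
  case (InfF n \<phi>)
  have "fm_val p M \<phi> (s(n := x)) = fm_val p M \<phi> (s'(n := x))" for x
    using InfF.prems by (intro InfF.IH) auto
  then show ?case by simp
next
  case (Scale r \<phi>)
  then show ?case by (metis fm_val.simps(4) free_vars.simps(4))
qed auto

text \<open>A bound uniform in the assignment gives \<open>SUP\<close> and \<open>INF\<close> over
  the reals their meaning, and survives quantification.\<close>

lemma fm_val_bounded: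
  assumes M: "structure_on p \<tau> M" and p: "1 \<le> p"
  shows "wf_fm \<tau> \<phi> \<Longrightarrow> \<exists>B. \<forall>s. (\<forall>n. s n \<in> str_carrier M) \<longrightarrow> \<bar>fm_val p M \<phi> s\<bar> \<le> B"
proof (induction \<phi>)
  case (Real r)
  then show ?case by auto
next
  case (DistP t u)
  have "\<bar>fm_val p M (DistP t u) s\<bar> \<le> 1" if "\<forall>n. s n \<in> str_carrier M" for s
    using structure_dist_powr_le_1[OF M p, of "trm_val M s t" "trm_val M s u"]
      trm_val_in_carrier[OF M, of s] that DistP by simp
  then show ?case by blast
next
  case (Rel R ts)
  have "\<bar>fm_val p M (Rel R ts) s\<bar> \<le> rel_bound \<tau> R" if "\<forall>n. s n \<in> str_carrier M" for s
    using structure_onD(7)[OF M] trm_vals_in_tuples[OF M, of s ts] that Rel by simp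
  then show ?case by blast
next
  case (Scale r \<phi>)
  then obtain B where B: "\<forall>s. (\<forall>n. s n \<in> str_carrier M) \<longrightarrow> \<bar>fm_val p M \<phi> s\<bar> \<le> B" by auto
  then have "\<forall>s. (\<forall>n. s n \<in> str_carrier M) \<longrightarrow> \<bar>fm_val p M (Scale r \<phi>) s\<bar> \<le> \<bar>r\<bar> * B"
    by (simp add: abs_mult mult_left_mono)
  then show ?case by blast
next
  case (Plus \<phi> \<psi>)
  then obtain A B where "\<forall>s. (\<forall>n. s n \<in> str_carrier M) \<longrightarrow> \<bar>fm_val p M \<phi> s\<bar> \<le> A"
    "\<forall>s. (\<forall>n. s n \<in> str_carrier M) \<longrightarrow> \<bar>fm_val p M \<psi> s\<bar> \<le> B" by auto
  then have "\<forall>s. (\<forall>n. s n \<in> str_carrier M) \<longrightarrow> \<bar>fm_val p M (Plus \<phi> \<psi>) s\<bar> \<le> A + B"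
    by (auto intro!: order_trans[OF abs_triangle_ineq] add_mono)
  then show ?case by blast
next
  case (SupF n \<phi>)
  then obtain B where B: "\<forall>s. (\<forall>n. s n \<in> str_carrier M) \<longrightarrow> \<bar>fm_val p M \<phi> s\<bar> \<le> B" by auto
  have "\<bar>fm_val p M (SupF n \<phi>) s\<bar> \<le> B" if "\<forall>n. s n \<in> str_carrier M" for s
    unfolding fm_val.simps
    by (rule cSup_abs_le) (use structure_onD(2)[OF M] B that in auto)
  then show ?case by blast
next
  case (InfF n \<phi>)
  then obtain B where B: "\<forall>s. (\<forall>n. s n \<in> str_carrier M) \<longrightarrow> \<bar>fm_val p M \<phi> s\<bar> \<le> B" by auto
  have "\<bar>fm_val p M (InfF n \<phi>) s\<bar> \<le> B" if "\<forall>n. s n \<in> str_carrier M" for s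
    unfolding fm_val.simps
    by (rule cInf_abs_ge) (use structure_onD(2)[OF M] B that in auto)
  then show ?case by blast
qed

lemma finite_trm_vars: "finite (trm_vars t)"
  by (induction t) auto

lemma finite_free_vars: "finite (free_vars \<phi>)"
  by (induction \<phi>) (auto simp: finite_trm_vars)

lemma elem_equiv_fm_val:
  assumes "elem_equiv p \<tau> M N" "wf_fm \<tau> \<phi>" "free_vars \<phi> = {}"
  shows "fm_val p M \<phi> s = fm_val p N \<phi> s'"
proof -
  have "fm_val p M \<phi> s = sentence_val p M \<phi>"
    unfolding sentence_val_def by (rule fm_val_cong) (simp add: assms(3))
  also have "\<dots> = sentence_val p N \<phi>"
    using assms by (simp add: elem_equiv_def is_sentence_def)
  also have "\<dots> = fm_val p N \<phi> s'"
    unfolding sentence_val_def by (rule fm_val_cong) (simp add: assms(3))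
  finally show ?thesis .
qed

section \<open>Quantifier-free formulas and renaming of variables\<close>

primrec qf :: "('f, 'r, 'c) fm \<Rightarrow> bool" where
  "qf (Real r) = True"
| "qf (DistP t u) = True"
| "qf (Rel R ts) = True"
| "qf (Scale r \<phi>) = qf \<phi>"
| "qf (Plus \<phi> \<psi>) = (qf \<phi> \<and> qf \<psi>)"
| "qf (SupF n \<phi>) = False"
| "qf (InfF n \<phi>) = False"

primrec rename_trm :: "(nat \<Rightarrow> nat) \<Rightarrow> ('f, 'c) trm \<Rightarrow> ('f, 'c) trm" where
  "rename_trm \<rho> (Var n) = Var (\<rho> n)"
| "rename_trm \<rho> (Cst c) = Cst c"
| "rename_trm \<rho> (App F ts) = App F (map (rename_trm \<rho>) ts)"

text \<open>Only applied to quantifier-free formulas.\<close>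

primrec rename_fm :: "(nat \<Rightarrow> nat) \<Rightarrow> ('f, 'r, 'c) fm \<Rightarrow> ('f, 'r, 'c) fm" where
  "rename_fm \<rho> (Real r) = Real r"
| "rename_fm \<rho> (DistP t u) = DistP (rename_trm \<rho> t) (rename_trm \<rho> u)"
| "rename_fm \<rho> (Rel R ts) = Rel R (map (rename_trm \<rho>) ts)"
| "rename_fm \<rho> (Scale r \<phi>) = Scale r (rename_fm \<rho> \<phi>)"
| "rename_fm \<rho> (Plus \<phi> \<psi>) = Plus (rename_fm \<rho> \<phi>) (rename_fm \<rho> \<psi>)"
| "rename_fm \<rho> (SupF n \<phi>) = SupF n \<phi>"
| "rename_fm \<rho> (InfF n \<phi>) = InfF n \<phi>"

lemma trm_val_rename: "trm_val M s (rename_trm \<rho> t) = trm_val M (\<lambda>n. s (\<rho> n)) t"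
proof (induction t)
  case (App F ts)
  then have "map (\<lambda>t. trm_val M s (rename_trm \<rho> t)) ts = map (trm_val M (\<lambda>n. s (\<rho> n))) ts" by simp
  then show ?case by (simp only: rename_trm.simps trm_val.simps map_map comp_def)
qed auto

lemma wf_trm_rename: "wf_trm \<tau> (rename_trm \<rho> t) \<longleftrightarrow> wf_trm \<tau> t"
  by (induction t) auto

lemma trm_vars_rename: "trm_vars (rename_trm \<rho> t) = \<rho> ` trm_vars t"
  by (induction t) auto

lemma fm_val_rename: "qf \<phi> \<Longrightarrow> fm_val p M (rename_fm \<rho> \<phi>) s = fm_val p M \<phi> (\<lambda>n. s (\<rho> n))"
  by (induction \<phi>) (auto simp: trm_val_rename comp_def)

lemma qf_rename: "qf \<phi> \<Longrightarrow> qf (rename_fm \<rho> \<phi>)"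
  by (induction \<phi>) auto

lemma wf_fm_rename: "qf \<phi> \<Longrightarrow> wf_fm \<tau> (rename_fm \<rho> \<phi>) \<longleftrightarrow> wf_fm \<tau> \<phi>"
  by (induction \<phi>) (auto simp: wf_trm_rename)

lemma free_vars_rename: "qf \<phi> \<Longrightarrow> free_vars (rename_fm \<rho> \<phi>) = \<rho> ` free_vars \<phi>"
  by (induction \<phi>) (auto simp: trm_vars_rename)

section \<open>Elimination of coordinates by quantifiers\<close>

lemma finite_wf_maximal:
  assumes "finite S" "S \<noteq> {}" "wf r"
  shows "\<exists>t\<in>S. \<forall>s\<in>S. (t, s) \<notin> r"
proof -
  have "acyclic (r \<inter> S \<times> S)"
    by (rule acyclic_subset[OF wf_acyclic[OF assms(3)]]) blast
  \<comment> \<open>A well-founded relation provides minimal elements, but a maximal one is wanted;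
    on a finite set acyclicity makes the converse well-founded too.\<close>
  then have "wf ((r \<inter> S \<times> S)\<inverse>)"
    by (intro finite_acyclic_wf_converse) (use assms(1) in auto)
  moreover obtain x where "x \<in> S" using assms(2) by blast
  ultimately obtain t where "t \<in> S" "\<And>s. (s, t) \<in> (r \<inter> S \<times> S)\<inverse> \<Longrightarrow> s \<notin> S"
    by (rule wfE_min) (rule that)
  then show ?thesis by blast
qed

text \<open>A coordinate \<open>t\<close> on which no other coordinate in sight depends is eliminated by a quantifier:
  by \<open>SupF\<close> if its second component can be chosen freely, by \<open>InfF\<close> if its first component can.\<close>

lemma fm_val_gap_small:
  fixes P :: "'t \<Rightarrow> 'i \<Rightarrow> 'a" and Q :: "'t \<Rightarrow> 'i \<Rightarrow> 'b"
  assumes M: "structure_on p \<tau> M" and N: "structure_on p \<tau> N" and p: "1 \<le> p"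
    and MN: "elem_equiv p \<tau> M N"
    and P: "\<And>t i. P t i \<in> str_carrier M" and Q: "\<And>t i. Q t i \<in> str_carrier N"
    and wf: "wf r"
    and free: "\<And>t.
      (\<forall>i. \<forall>y\<in>str_carrier N. \<exists>j. Q t j = y \<and> P t j = P t i \<and>
        (\<forall>s. s \<noteq> t \<longrightarrow> (t, s) \<notin> r \<longrightarrow> P s j = P s i \<and> Q s j = Q s i)) \<or>
      (\<forall>i. \<forall>x\<in>str_carrier M. \<exists>j. P t j = x \<and> Q t j = Q t i \<and>
        (\<forall>s. s \<noteq> t \<longrightarrow> (t, s) \<notin> r \<longrightarrow> P s j = P s i \<and> Q s j = Q s i))"
    and "wf_fm \<tau> \<phi>" "inj_on \<sigma> (free_vars \<phi>)" "0 < e"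
  shows "\<exists>i. fm_val p M \<phi> (\<lambda>n. P (\<sigma> n) i) - fm_val p N \<phi> (\<lambda>n. Q (\<sigma> n) i) < e"
  using assms(9-11)
\<comment> \<open>Each quantifier binds one variable; \<open>e\<close> varies because every step
  spends half of it.\<close>
proof (induction "card (free_vars \<phi>)" arbitrary: \<phi> e)
  case 0
  then have "free_vars \<phi> = {}" using finite_free_vars[of \<phi>] by simp
  then show ?case
    using elem_equiv_fm_val[OF MN 0(2)] 0(4) by (metis diff_self)
next
  case (Suc k)
  let ?S = "\<sigma> ` free_vars \<phi>"
  have "?S \<noteq> {}" using Suc.hyps(2) by auto
  then obtain n where n: "n \<in> free_vars \<phi>" and top: "\<And>m. m \<in> free_vars \<phi> \<Longrightarrow> (\<sigma> n, \<sigma> m) \<notin> r"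
    using finite_wf_maximal[OF _ _ wf, of ?S] finite_free_vars by blast
  \<comment> \<open>By injectivity, changing the coordinate \<open>\<sigma> n\<close> moves no
    variable other than \<open>n\<close>.\<close>
  have ne: "\<sigma> m \<noteq> \<sigma> n" if "m \<in> free_vars \<phi>" "m \<noteq> n" for m
    using inj_onD[OF Suc.prems(2) _ that(1) n] that(2) by blast
  have k: "k = card (free_vars \<phi> - {n})"
    using Suc.hyps(2) n by (simp add: card_Diff_singleton)
  have inj: "inj_on \<sigma> (free_vars \<phi> - {n})"
    using Suc.prems(2) by (rule inj_on_subset) blast
  obtain BM where BM: "\<forall>s. (\<forall>n. s n \<in> str_carrier M) \<longrightarrow> \<bar>fm_val p M \<phi> s\<bar> \<le> BM"
    using fm_val_bounded[OF M p Suc.prems(1)] by blast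
  obtain BN where BN: "\<forall>s. (\<forall>n. s n \<in> str_carrier N) \<longrightarrow> \<bar>fm_val p N \<phi> s\<bar> \<le> BN"
    using fm_val_bounded[OF N p Suc.prems(1)] by blast
  define a where "a = (\<lambda>i x. fm_val p M \<phi> ((\<lambda>m. P (\<sigma> m) i)(n := x)))"
  define b where "b = (\<lambda>i y. fm_val p N \<phi> ((\<lambda>m. Q (\<sigma> m) i)(n := y)))"
  have a_bound: "\<bar>a i x\<bar> \<le> BM" if "x \<in> str_carrier M" for i x
    unfolding a_def by (rule BM[rule_format]) (use that P in auto)
  have b_bound: "\<bar>b i y\<bar> \<le> BN" if "y \<in> str_carrier N" for i y
    unfolding b_def by (rule BN[rule_format]) (use that Q in auto)
  have a_bdd: "bdd_above (a i ` str_carrier M)" "bdd_below (a i ` str_carrier M)" for i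
    using a_bound[of _ i] by (auto intro!: bdd_aboveI2[of _ _ BM] bdd_belowI2[of _ "- BM"] simp: abs_le_iff)
      (metis minus_le_iff)
  have b_bdd: "bdd_above (b i ` str_carrier N)" "bdd_below (b i ` str_carrier N)" for i
    using b_bound[of _ i] by (auto intro!: bdd_aboveI2[of _ _ BN] bdd_belowI2[of _ "- BN"] simp: abs_le_iff)
      (metis minus_le_iff)
  have e2: "0 < e / 2" using Suc.prems(3) by simp
  \<comment> \<open>The remaining variables sit at coordinates that are neither
    \<open>\<sigma> n\<close> nor, by \<open>top\<close>, above it in \<open>r\<close>, so going
    from \<open>i\<close> to \<open>j\<close> affects only the value of \<open>n\<close>.\<close>
  have move: "fm_val p M \<phi> (\<lambda>m. P (\<sigma> m) j) = a i (P (\<sigma> n) j)"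
      "fm_val p N \<phi> (\<lambda>m. Q (\<sigma> m) j) = b i (Q (\<sigma> n) j)"
    if "\<forall>s. s \<noteq> \<sigma> n \<longrightarrow> (\<sigma> n, s) \<notin> r \<longrightarrow> P s j = P s i \<and> Q s j = Q s i" for i j
    unfolding a_def b_def by (rule fm_val_cong, use that top ne in auto)+
  from free[of "\<sigma> n"] show ?case
  proof
    assume free: "\<forall>i. \<forall>y\<in>str_carrier N. \<exists>j. Q (\<sigma> n) j = y \<and> P (\<sigma> n) j = P (\<sigma> n) i \<and>
        (\<forall>s. s \<noteq> \<sigma> n \<longrightarrow> (\<sigma> n, s) \<notin> r \<longrightarrow> P s j = P s i \<and> Q s j = Q s i)"
    obtain i where "fm_val p M (SupF n \<phi>) (\<lambda>m. P (\<sigma> m) i) - fm_val p N (SupF n \<phi>) (\<lambda>m. Q (\<sigma> m) i) < e/2"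
      using Suc.hyps(1)[of "SupF n \<phi>" "e/2"] k inj Suc.prems(1) e2 by auto
    then have i: "(SUP x\<in>str_carrier M. a i x) - (SUP y\<in>str_carrier N. b i y) < e/2"
      by (simp add: a_def b_def)
    have "(SUP y\<in>str_carrier N. b i y) - e/2 < (SUP y\<in>str_carrier N. b i y)" using e2 by simp
    then obtain y where y: "y \<in> str_carrier N" "(SUP y\<in>str_carrier N. b i y) - e/2 < b i y"
      using less_cSUP_iff[OF structure_onD(2)[OF N] b_bdd(1)] by blast
    obtain j where j: "Q (\<sigma> n) j = y" "P (\<sigma> n) j = P (\<sigma> n) i"
      "\<forall>s. s \<noteq> \<sigma> n \<longrightarrow> (\<sigma> n, s) \<notin> r \<longrightarrow> P s j = P s i \<and> Q s j = Q s i"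
      using free y(1) by blast
    \<comment> \<open>The prescribed side needs no control: its value is below the supremum anyway.
      The free side \<open>y\<close> comes within \<open>e/2\<close> of its supremum, and the
      induction hypothesis accounts for the other half.\<close>
    have "a i (P (\<sigma> n) j) \<le> (SUP x\<in>str_carrier M. a i x)"
      by (rule cSUP_upper[OF P a_bdd(1)])
    then have "fm_val p M \<phi> (\<lambda>m. P (\<sigma> m) j) - fm_val p N \<phi> (\<lambda>m. Q (\<sigma> m) j) < e"
      using i y(2) move[OF j(3)] j(1) by simp
    then show ?thesis by blast
  next
    assume free: "\<forall>i. \<forall>x\<in>str_carrier M. \<exists>j. P (\<sigma> n) j = x \<and> Q (\<sigma> n) j = Q (\<sigma> n) i \<and>
        (\<forall>s. s \<noteq> \<sigma> n \<longrightarrow> (\<sigma> n, s) \<notin> r \<longrightarrow> P s j = P s i \<and> Q s j = Q s i)"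
    obtain i where "fm_val p M (InfF n \<phi>) (\<lambda>m. P (\<sigma> m) i) - fm_val p N (InfF n \<phi>) (\<lambda>m. Q (\<sigma> m) i) < e/2"
      using Suc.hyps(1)[of "InfF n \<phi>" "e/2"] k inj Suc.prems(1) e2 by auto
    then have i: "(INF x\<in>str_carrier M. a i x) - (INF y\<in>str_carrier N. b i y) < e/2"
      by (simp add: a_def b_def)
    have "(INF x\<in>str_carrier M. a i x) < (INF x\<in>str_carrier M. a i x) + e/2" using e2 by simp
    then obtain x where x: "x \<in> str_carrier M" "a i x < (INF x\<in>str_carrier M. a i x) + e/2"
      using cINF_less_iff[OF structure_onD(2)[OF M] a_bdd(2)] by blast
    obtain j where j: "P (\<sigma> n) j = x" "Q (\<sigma> n) j = Q (\<sigma> n) i"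
      "\<forall>s. s \<noteq> \<sigma> n \<longrightarrow> (\<sigma> n, s) \<notin> r \<longrightarrow> P s j = P s i \<and> Q s j = Q s i"
      using free x(1) by blast
    have "(INF y\<in>str_carrier N. b i y) \<le> b i (Q (\<sigma> n) j)"
      by (rule cINF_lower[OF b_bdd(2) Q])
    then have "fm_val p M \<phi> (\<lambda>m. P (\<sigma> m) j) - fm_val p N \<phi> (\<lambda>m. Q (\<sigma> m) j) < e"
      using i x(2) move[OF j(3)] j(1) by simp
    then show ?thesis by blast
  qed
qed

text \<open>To remove injectivity of \<open>\<sigma>\<close>, variables sent to the same coordinate
  are identified: variable \<open>n\<close> is renamed to a number \<open>h (\<sigma> n)\<close> of
  its coordinate. Without quantifiers no variable can be captured.\<close>

lemma qf_fm_val_gap_small: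
  fixes P :: "'t \<Rightarrow> 'i \<Rightarrow> 'a" and Q :: "'t \<Rightarrow> 'i \<Rightarrow> 'b" and \<phi> :: "('f, 'r, 'c) fm"
  assumes gap: "\<And>(\<phi> :: ('f, 'r, 'c) fm) \<sigma> e. wf_fm \<tau> \<phi> \<Longrightarrow> inj_on \<sigma> (free_vars \<phi>) \<Longrightarrow> 0 < e \<Longrightarrow>
      \<exists>i. fm_val p M \<phi> (\<lambda>n. P (\<sigma> n) i) - fm_val p N \<phi> (\<lambda>n. Q (\<sigma> n) i) < e"
    and \<phi>: "wf_fm \<tau> \<phi>" "qf \<phi>" and e: "0 < (e::real)"
  shows "\<exists>i. fm_val p M \<phi> (\<lambda>n. P (\<sigma> n) i) - fm_val p N \<phi> (\<lambda>n. Q (\<sigma> n) i) < e"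
proof -
  have "finite (\<sigma> ` free_vars \<phi>)" using finite_free_vars by blast
  then obtain h :: "'t \<Rightarrow> nat" where h: "inj_on h (\<sigma> ` free_vars \<phi>)"
    using finite_imp_inj_to_nat_seg by blast
  define \<sigma>' where "\<sigma>' = inv_into (\<sigma> ` free_vars \<phi>) h"
  define \<phi>' where "\<phi>' = rename_fm (\<lambda>n. h (\<sigma> n)) \<phi>"
  have \<sigma>': "\<sigma>' (h (\<sigma> n)) = \<sigma> n" if "n \<in> free_vars \<phi>" for n
    unfolding \<sigma>'_def by (rule inv_into_f_f[OF h]) (use that in blast)
  have "free_vars \<phi>' = h ` \<sigma> ` free_vars \<phi>"
    unfolding \<phi>'_def free_vars_rename[OF \<phi>(2)] by (simp add: image_image)
  then have "inj_on \<sigma>' (free_vars \<phi>')"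
    unfolding \<sigma>'_def by (simp add: inj_on_inv_into)
  moreover have "wf_fm \<tau> \<phi>'" unfolding \<phi>'_def using wf_fm_rename \<phi> by blast
  ultimately obtain i where i: "fm_val p M \<phi>' (\<lambda>n. P (\<sigma>' n) i) - fm_val p N \<phi>' (\<lambda>n. Q (\<sigma>' n) i) < e"
    using gap e by blast
  have "fm_val p M \<phi>' (\<lambda>n. P (\<sigma>' n) i) = fm_val p M \<phi> (\<lambda>n. P (\<sigma> n) i)"
    unfolding \<phi>'_def fm_val_rename[OF \<phi>(2)] by (rule fm_val_cong) (simp add: \<sigma>')
  moreover have "fm_val p N \<phi>' (\<lambda>n. Q (\<sigma>' n) i) = fm_val p N \<phi> (\<lambda>n. Q (\<sigma> n) i)"
    unfolding \<phi>'_def fm_val_rename[OF \<phi>(2)] by (rule fm_val_cong) (simp add: \<sigma>')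
  ultimately show ?thesis using i by auto
qed

section \<open>Powermeans over the charge of a mean\<close>

abbreviation mean_charge :: "(('i \<Rightarrow> real) \<Rightarrow> real) \<Rightarrow> 'i set \<Rightarrow> real" where
  "mean_charge L X \<equiv> L (indicator X)"

text \<open>The assumption \<open>meas\<close> asks for the preimages of all sets under finite
  tuples of measurable maps. Hence any bounded real function of such a tuple is integrable, and any
  function of it with values in the carrier is again a measurable map.\<close>

locale mean_structure =
  fixes p :: real and \<tau> :: "('f, 'r, 'c) signature" and M :: "('a, 'f, 'r, 'c) struct"
    and L :: "('i \<Rightarrow> real) \<Rightarrow> real" and \<A> :: "'i set set"
  assumes p: "1 \<le> p" and wf_\<tau>: "wf_signature \<tau>" and M: "structure_on p \<tau> M" and L: "mean L"
    and meas: "set as \<subseteq> meas_maps UNIV \<A> M \<Longrightarrow> (\<lambda>i. map (\<lambda>a. a i) as) -` X \<in> \<A>"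
begin

abbreviation "maps \<equiv> meas_maps UNIV \<A> M"
abbreviation "rel \<equiv> mean_rel p UNIV \<A> (mean_charge L) M"
abbreviation "cls a \<equiv> rel `` {a}"
abbreviation "dp a b \<equiv> (\<lambda>i. str_dist M (a i) (b i) powr p)"
abbreviation "PM \<equiv> powermean p UNIV \<A> (mean_charge L) M"

lemma maps_in: "a \<in> maps \<Longrightarrow> a i \<in> str_carrier M"
  by (auto simp: meas_maps_def)

lemma maps_tuple: "set as \<subseteq> maps \<Longrightarrow> map (\<lambda>a. a i) as \<in> tuples (str_carrier M) (length as)"
  using maps_in by (auto simp: tuples_def)

lemma maps_comp:
  assumes "set as \<subseteq> maps" "\<And>i. g (map (\<lambda>a. a i) as) \<in> str_carrier M"
  shows "(\<lambda>i. g (map (\<lambda>a. a i) as)) \<in> maps"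
proof -
  have "(\<lambda>i. g (map (\<lambda>a. a i) as)) -` X = (\<lambda>i. map (\<lambda>a. a i) as) -` (g -` X)" for X by auto
  then have "(\<lambda>i. g (map (\<lambda>a. a i) as)) -` X \<in> \<A>" for X using meas[OF assms(1)] by simp
  then show ?thesis using assms(2) by (simp add: meas_maps_def PiE_UNIV_domain)
qed

lemma integral_eq_mean:
  assumes "set as \<subseteq> maps" "bounded (range (\<lambda>i. g (map (\<lambda>a. a i) as)))"
  shows "charge_integral UNIV \<A> (mean_charge L) (\<lambda>i. g (map (\<lambda>a. a i) as))
    = L (\<lambda>i. g (map (\<lambda>a. a i) as))"
proof (rule charge_integral_eq_mean[OF L assms(2)])
  fix X
  have "(\<lambda>i. g (map (\<lambda>a. a i) as)) -` X = (\<lambda>i. map (\<lambda>a. a i) as) -` (g -` X)" by auto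
  then show "(\<lambda>i. g (map (\<lambda>a. a i) as)) -` X \<in> \<A>" using meas[OF assms(1)] by simp
qed

lemma bounded_dp: "a \<in> maps \<Longrightarrow> b \<in> maps \<Longrightarrow> bounded (range (dp a b))"
  unfolding bounded_range_iff
  by (intro exI[of _ 1]) (use structure_dist_powr_le_1[OF M p] maps_in in auto)

lemma integral_dp:
  assumes "a \<in> maps" "b \<in> maps"
  shows "charge_integral UNIV \<A> (mean_charge L) (dp a b) = L (dp a b)"
  using integral_eq_mean[of "[a, b]" "\<lambda>xs. str_dist M (xs ! 0) (xs ! 1) powr p"]
    assms bounded_dp[OF assms] by simp

lemma rel_iff: "(a, b) \<in> rel \<longleftrightarrow> a \<in> maps \<and> b \<in> maps \<and> L (dp a b) = 0"
  by (auto simp: mean_rel_def integral_dp)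

lemma rel_refl: "a \<in> maps \<Longrightarrow> (a, a) \<in> rel"
  using p structure_dist(2)[OF M] maps_in mean_const[OF L, of 0] by (simp add: rel_iff)

lemma rel_sym: "(a, b) \<in> rel \<Longrightarrow> (b, a) \<in> rel"
  by (simp add: rel_iff structure_dist(3)[OF M])

text \<open>Both distances differ little wherever \<open>dp a a'\<close> and \<open>dp b b'\<close>
  are small, by the triangle inequality and uniform continuity of the \<open>p\<close>-th power on
  the unit interval. Transitivity of \<open>rel\<close> is a special case.\<close>

lemma mean_dp_cong:
  assumes "(a, a') \<in> rel" "(b, b') \<in> rel"
  shows "L (dp a b) = L (dp a' b')"
proof -
  have m: "a \<in> maps" "a' \<in> maps" "b \<in> maps" "b' \<in> maps"
    and z: "L (dp a a') = 0" "L (dp b b') = 0" using assms by (auto simp: rel_iff)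
  have bd: "bounded (range (\<lambda>i. dp a a' i + dp b b' i))"
    by (intro bounded_range_add bounded_dp m)
  have "L (\<lambda>i. dp a b i - dp a' b' i) = 0"
  proof (rule mean_eq_0I[OF L bd])
    show "L (\<lambda>i. dp a a' i + dp b b' i) = 0"
      using mean_add[OF L bounded_dp[OF m(1,2)] bounded_dp[OF m(3,4)]] z by simp
    show "bounded (range (\<lambda>i. dp a b i - dp a' b' i))"
      by (intro bounded_range_diff bounded_dp m)
    show "0 \<le> dp a a' i + dp b b' i" for i by simp
  next
    fix e :: real assume "0 < e"
    obtain \<delta> where \<delta>: "0 < \<delta>"
      "\<forall>x\<in>{0..1}. \<forall>y\<in>{0..1}. \<bar>x - y\<bar> < \<delta> \<longrightarrow> \<bar>x powr p - y powr p\<bar> < e"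
      using abs_powr_diff_small[OF p \<open>0 < e\<close>] by blast
    \<comment> \<open>Below \<open>(\<delta> / 2) powr p\<close> both representatives move by less
      than \<open>\<delta> / 2\<close>, so the distance changes by less than
      \<open>\<delta>\<close>.\<close>
    have "\<bar>dp a b i - dp a' b' i\<bar> \<le> e" if i: "dp a a' i + dp b b' i < (\<delta> / 2) powr p" for i
    proof -
      note c = maps_in[OF m(1), of i] maps_in[OF m(2), of i] maps_in[OF m(3), of i] maps_in[OF m(4), of i]
      have small: "str_dist M x y < \<delta> / 2" if "str_dist M x y powr p < (\<delta> / 2) powr p" for x y
        using powr_mono2[of p "\<delta> / 2" "str_dist M x y"] that p \<delta>(1) by force
      have "0 \<le> dp a a' i" "0 \<le> dp b b' i" by simp_all
      then have "dp a a' i < (\<delta> / 2) powr p" "dp b b' i < (\<delta> / 2) powr p" using i by linarith+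
      then have "str_dist M (a i) (a' i) < \<delta> / 2" "str_dist M (b i) (b' i) < \<delta> / 2"
        by (simp_all only: small)
      moreover have "str_dist M (a i) (b i) \<le> str_dist M (a i) (a' i) + str_dist M (a' i) (b' i) + str_dist M (b i) (b' i)"
        using structure_dist(4)[OF M c(1) c(2) c(3)] structure_dist(4)[OF M c(2) c(4) c(3)]
          structure_dist(3)[OF M, of "b i" "b' i"] by linarith
      moreover have "str_dist M (a' i) (b' i) \<le> str_dist M (a i) (a' i) + str_dist M (a i) (b i) + str_dist M (b i) (b' i)"
        using structure_dist(4)[OF M c(2) c(1) c(4)] structure_dist(4)[OF M c(1) c(3) c(4)]
          structure_dist(3)[OF M, of "a i" "a' i"] by linarith
      ultimately have "\<bar>str_dist M (a i) (b i) - str_dist M (a' i) (b' i)\<bar> < \<delta>" by linarith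
      then show ?thesis
        using \<delta>(2) structure_dist(1)[OF M] structure_onD(3)[OF M c(1) c(3)]
          structure_onD(3)[OF M c(2) c(4)] by (simp add: less_imp_le)
    qed
    moreover have "0 < (\<delta> / 2) powr p" using \<delta>(1) by simp
    ultimately show "\<exists>\<delta>>0. \<forall>i. dp a a' i + dp b b' i < \<delta> \<longrightarrow> \<bar>dp a b i - dp a' b' i\<bar> \<le> e"
      by blast
  qed
  then show ?thesis
    using mean_diff[OF L bounded_dp[OF m(1,3)] bounded_dp[OF m(2,4)]] by simp
qed

lemma equiv_rel: "equiv maps rel"
proof (rule equivI)
  show "rel \<subseteq> maps \<times> maps" by (auto simp: rel_iff)
  show "refl_on maps rel" by (auto simp: refl_on_def rel_refl)
  show "sym rel" by (rule symI) (rule rel_sym)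
  show "trans rel"
  proof (rule transI)
    fix a b c assume *: "(a, b) \<in> rel" "(b, c) \<in> rel"
    then have "L (dp a c) = L (dp b c)"
      by (intro mean_dp_cong rel_refl) (auto simp: rel_iff)
    then show "(a, c) \<in> rel" using * by (simp add: rel_iff)
  qed
qed

text \<open>Here \<open>z\<close> is the \<open>p\<close>-th power of the tuple distance of
  representatives. It is the null function fed to \<open>mean_eq_0I\<close> for relation and
  function symbols alike.\<close>

lemma null_tuple:
  assumes "list_all2 (\<lambda>a b. (a, b) \<in> rel) as bs"
  defines "z \<equiv> (\<lambda>i. \<Sum>k<length as. dp (as ! k) (bs ! k) i)"
  shows "bounded (range z)" "0 \<le> z i" "L z = 0"
    and "tuple_dist p (str_dist M) (map (\<lambda>a. a i) as) (map (\<lambda>b. b i) bs) = z i powr (1 / p)"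
proof -
  have len: "length bs = length as" using assms(1) by (simp add: list_all2_lengthD)
  have r: "(as ! k, bs ! k) \<in> rel" if "k < length as" for k
    using assms(1) that by (simp add: list_all2_conv_all_nth)
  then have b: "bounded (range (dp (as ! k) (bs ! k)))" if "k \<in> {..<length as}" for k
    using that by (intro bounded_dp) (auto simp: rel_iff)
  then show "bounded (range z)" unfolding z_def by (rule bounded_range_sum)
  show "0 \<le> z i" unfolding z_def by (intro sum_nonneg) simp
  have "L z = (\<Sum>k<length as. L (dp (as ! k) (bs ! k)))"
    unfolding z_def by (rule mean_sum[OF L _ b]) auto
  also have "\<dots> = 0" using r by (intro sum.neutral) (auto simp: rel_iff)
  finally show "L z = 0" .
  show "tuple_dist p (str_dist M) (map (\<lambda>a. a i) as) (map (\<lambda>b. b i) bs) = z i powr (1 / p)"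
    using len by (auto simp: tuple_dist_def z_def intro!: arg_cong[of _ _ "\<lambda>x. x powr (1/p)"] sum.cong)
qed

lemma list_all2_maps:
  assumes "list_all2 (\<lambda>a b. (a, b) \<in> rel) as bs"
  shows "set as \<subseteq> maps" "set bs \<subseteq> maps" "length bs = length as"
  using assms by (auto simp: list_all2_conv_all_nth in_set_conv_nth rel_iff)

lemma bounded_str_rel:
  assumes "R \<in> sig_rels \<tau>" "set as \<subseteq> maps" "length as = rel_arity \<tau> R"
  shows "bounded (range (\<lambda>i. str_rel M R (map (\<lambda>a. a i) as)))"
  unfolding bounded_range_iff
  using structure_onD(7)[OF M assms(1)] maps_tuple[OF assms(2)] assms(3) by auto

lemma mean_str_rel_cong:
  assumes R: "R \<in> sig_rels \<tau>" and eq: "list_all2 (\<lambda>a b. (a, b) \<in> rel) as bs"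
    and len: "length as = rel_arity \<tau> R"
  shows "L (\<lambda>i. str_rel M R (map (\<lambda>a. a i) as)) = L (\<lambda>i. str_rel M R (map (\<lambda>b. b i) bs))"
proof -
  note m = list_all2_maps[OF eq] and z = null_tuple[OF eq]
  have b: "bounded (range (\<lambda>i. str_rel M R (map (\<lambda>a. a i) as)))"
    "bounded (range (\<lambda>i. str_rel M R (map (\<lambda>b. b i) bs)))"
    using bounded_str_rel[OF R] m len by auto
  have "L (\<lambda>i. str_rel M R (map (\<lambda>a. a i) as) - str_rel M R (map (\<lambda>b. b i) bs)) = 0"
  proof (rule mean_eq_0I[OF L z(1-3) bounded_range_diff[OF b]])
    fix e :: real assume "0 < e"
    moreover have "modulus (rel_modulus \<tau> R)" using wf_\<tau> R by (simp add: wf_signature_def)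
    ultimately obtain \<delta> where \<delta>: "0 < \<delta>"
      "\<forall>x. 0 \<le> x \<longrightarrow> x < \<delta> \<longrightarrow> rel_modulus \<tau> R (x powr (1 / p)) < e"
      using modulus_small[OF _ p] by blast
    have "\<bar>str_rel M R (map (\<lambda>a. a i) as) - str_rel M R (map (\<lambda>b. b i) bs)\<bar> \<le> e"
      if "(\<Sum>k<length as. dp (as ! k) (bs ! k) i) < \<delta>" for i
    proof -
      have "\<bar>str_rel M R (map (\<lambda>a. a i) as) - str_rel M R (map (\<lambda>b. b i) bs)\<bar>
        \<le> rel_modulus \<tau> R (tuple_dist p (str_dist M) (map (\<lambda>a. a i) as) (map (\<lambda>b. b i) bs))"
        using structure_onD(8)[OF M R] maps_tuple[OF m(1)] maps_tuple[OF m(2)] m(3) len by simp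
      then show ?thesis using \<delta>(2)[rule_format, OF z(2) that] z(4)[of i] by simp
    qed
    then show "\<exists>\<delta>>0. \<forall>i. (\<Sum>k<length as. dp (as ! k) (bs ! k) i) < \<delta> \<longrightarrow>
        \<bar>str_rel M R (map (\<lambda>a. a i) as) - str_rel M R (map (\<lambda>b. b i) bs)\<bar> \<le> e"
      using \<delta>(1) by blast
  qed
  then show ?thesis using mean_diff[OF L b] by simp
qed

lemma str_fun_maps:
  assumes "F \<in> sig_funs \<tau>" "set as \<subseteq> maps" "length as = fun_arity \<tau> F"
  shows "(\<lambda>i. str_fun M F (map (\<lambda>a. a i) as)) \<in> maps"
  using structure_onD(5)[OF M assms(1)] maps_tuple[OF assms(2)] assms(3)
  by (intro maps_comp[OF assms(2)]) simp

lemma str_fun_rel_cong: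
  assumes F: "F \<in> sig_funs \<tau>" and eq: "list_all2 (\<lambda>a b. (a, b) \<in> rel) as bs"
    and len: "length as = fun_arity \<tau> F"
  shows "(\<lambda>i. str_fun M F (map (\<lambda>a. a i) as), \<lambda>i. str_fun M F (map (\<lambda>b. b i) bs)) \<in> rel"
proof -
  note m = list_all2_maps[OF eq] and z = null_tuple[OF eq]
  have mF: "(\<lambda>i. str_fun M F (map (\<lambda>a. a i) as)) \<in> maps" "(\<lambda>i. str_fun M F (map (\<lambda>b. b i) bs)) \<in> maps"
    using str_fun_maps[OF F] m len by auto
  have "L (dp (\<lambda>i. str_fun M F (map (\<lambda>a. a i) as)) (\<lambda>i. str_fun M F (map (\<lambda>b. b i) bs))) = 0"
  proof (rule mean_eq_0I[OF L z(1-3) bounded_dp[OF mF]])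
    fix e :: real assume e: "0 < e"
    \<comment> \<open>The integrand is a \<open>p\<close>-th power of a distance, so the distance
      itself must get below the \<open>p\<close>-th root of \<open>e\<close>.\<close>
    then have "0 < e powr (1 / p)" by simp
    moreover have "modulus (fun_modulus \<tau> F)" using wf_\<tau> F by (simp add: wf_signature_def)
    ultimately obtain \<delta> where \<delta>: "0 < \<delta>"
      "\<forall>x. 0 \<le> x \<longrightarrow> x < \<delta> \<longrightarrow> fun_modulus \<tau> F (x powr (1 / p)) < e powr (1 / p)"
      using modulus_small[OF _ p] by blast
    have "\<bar>dp (\<lambda>i. str_fun M F (map (\<lambda>a. a i) as)) (\<lambda>i. str_fun M F (map (\<lambda>b. b i) bs)) i\<bar> \<le> e"
      if "(\<Sum>k<length as. dp (as ! k) (bs ! k) i) < \<delta>" for i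
    proof -
      have "str_dist M (str_fun M F (map (\<lambda>a. a i) as)) (str_fun M F (map (\<lambda>b. b i) bs))
        \<le> fun_modulus \<tau> F (tuple_dist p (str_dist M) (map (\<lambda>a. a i) as) (map (\<lambda>b. b i) bs))"
        using structure_onD(6)[OF M F] maps_tuple[OF m(1)] maps_tuple[OF m(2)] m(3) len by simp
      also have "\<dots> \<le> e powr (1 / p)" using \<delta>(2)[rule_format, OF z(2) that] z(4)[of i] by simp
      finally have "dp (\<lambda>i. str_fun M F (map (\<lambda>a. a i) as)) (\<lambda>i. str_fun M F (map (\<lambda>b. b i) bs)) i
        \<le> (e powr (1 / p)) powr p"
        using p structure_dist(1)[OF M] by (intro powr_mono2) auto
      then show ?thesis using e p by (simp add: powr_powr)
    qed
    then show "\<exists>\<delta>>0. \<forall>i. (\<Sum>k<length as. dp (as ! k) (bs ! k) i) < \<delta> \<longrightarrow>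
        \<bar>dp (\<lambda>i. str_fun M F (map (\<lambda>a. a i) as)) (\<lambda>i. str_fun M F (map (\<lambda>b. b i) bs)) i\<bar> \<le> e"
      using \<delta>(1) by blast
  qed
  then show ?thesis using mF by (simp add: rel_iff)
qed

section \<open>The operations of the powermean computed on classes\<close>

lemma cls_eq_iff: "a \<in> maps \<Longrightarrow> b \<in> maps \<Longrightarrow> cls a = cls b \<longleftrightarrow> L (dp a b) = 0"
  using eq_equiv_class_iff[OF equiv_rel] by (simp add: rel_iff)

lemma repr_cls: "a \<in> maps \<Longrightarrow> (repr (cls a), a) \<in> rel"
  unfolding repr_def by (rule rel_sym, rule someI2[of _ a]) (auto simp: rel_refl)

lemma repr_list: "set as \<subseteq> maps \<Longrightarrow> list_all2 (\<lambda>a b. (a, b) \<in> rel) (map (\<lambda>a. repr (cls a)) as) as"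
  using repr_cls by (simp add: list_all2_conv_all_nth subset_iff)

lemma powermean_carrier: "str_carrier PM = cls ` maps"
  by (auto simp: powermean_def quotient_def)

lemma powermean_dist:
  assumes "a \<in> maps" "b \<in> maps"
  shows "str_dist PM (cls a) (cls b) = L (dp a b) powr (1 / p)"
proof -
  note r = repr_cls[OF assms(1)] repr_cls[OF assms(2)]
  then have "repr (cls a) \<in> maps" "repr (cls b) \<in> maps" by (auto simp: rel_iff)
  then show ?thesis
    using integral_dp mean_dp_cong[OF r] by (simp add: powermean_def)
qed

lemma powermean_const:
  "str_const PM c = cls (\<lambda>i. str_const M c)"
  by (simp add: powermean_def restrict_def)

lemma powermean_fun:
  assumes "F \<in> sig_funs \<tau>" "set as \<subseteq> maps" "length as = fun_arity \<tau> F"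
  shows "str_fun PM F (map cls as) = cls (\<lambda>i. str_fun M F (map (\<lambda>a. a i) as))"
proof -
  have "(\<lambda>i. str_fun M F (map (\<lambda>a. a i) (map (\<lambda>a. repr (cls a)) as)), \<lambda>i. str_fun M F (map (\<lambda>a. a i) as)) \<in> rel"
    by (rule str_fun_rel_cong[OF assms(1) repr_list[OF assms(2)]]) (simp add: assms(3))
  from equiv_class_eq[OF equiv_rel this] show ?thesis
    by (simp add: powermean_def comp_def restrict_def)
qed

lemma powermean_rel:
  assumes "R \<in> sig_rels \<tau>" "set as \<subseteq> maps" "length as = rel_arity \<tau> R"
  shows "str_rel PM R (map cls as) = L (\<lambda>i. str_rel M R (map (\<lambda>a. a i) as))"
proof -
  let ?bs = "map (\<lambda>a. repr (cls a)) as"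
  note r = repr_list[OF assms(2)]
  have "str_rel PM R (map cls as) = charge_integral UNIV \<A> (mean_charge L) (\<lambda>i. str_rel M R (map (\<lambda>a. a i) ?bs))"
    by (simp add: powermean_def comp_def)
  also have "\<dots> = L (\<lambda>i. str_rel M R (map (\<lambda>a. a i) ?bs))"
    by (rule integral_eq_mean bounded_str_rel[OF assms(1)] list_all2_maps(1)[OF r])+
      (simp add: assms(3))
  also have "\<dots> = L (\<lambda>i. str_rel M R (map (\<lambda>a. a i) as))"
    by (rule mean_str_rel_cong[OF assms(1) r]) (simp add: assms(3))
  finally show ?thesis .
qed

end

text \<open>Balancing \<open>DistP (Var 0) (Var 1)\<close> makes the assignment of classes well
  defined, injective and isometric at once; it is defined everywhere and onto since \<open>P\<close>
  and \<open>Q\<close> run through all measurable maps.\<close>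

lemma isomorphic_powermeans:
  fixes P :: "'t \<Rightarrow> 'i \<Rightarrow> 'a" and Q :: "'t \<Rightarrow> 'i \<Rightarrow> 'b"
    and \<tau> :: "('f, 'r, 'c) signature" and M :: "('a, 'f, 'r, 'c) struct" and N :: "('b, 'f, 'r, 'c) struct"
  assumes MM: "mean_structure p \<tau> M L \<A>" and NN: "mean_structure p \<tau> N L \<A>"
    and P: "range P = meas_maps UNIV \<A> M" and Q: "range Q = meas_maps UNIV \<A> N"
    and bal: "\<And>(\<phi> :: ('f, 'r, 'c) fm) \<sigma>. wf_fm \<tau> \<phi> \<Longrightarrow> qf \<phi> \<Longrightarrow>
      L (\<lambda>i. fm_val p M \<phi> (\<lambda>n. P (\<sigma> n) i)) = L (\<lambda>i. fm_val p N \<phi> (\<lambda>n. Q (\<sigma> n) i))"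
  shows "isomorphic_structs \<tau> (powermean p UNIV \<A> (mean_charge L) M)
    (powermean p UNIV \<A> (mean_charge L) N)"
proof -
  interpret M: mean_structure p \<tau> M L \<A> by (rule MM)
  interpret N: mean_structure p \<tau> N L \<A> by (rule NN)
  have Pm: "P t \<in> M.maps" and Qm: "Q t \<in> N.maps" for t using P Q by auto
  have dist: "L (M.dp (P s) (P t)) = L (N.dp (Q s) (Q t))" for s t
    using bal[of "DistP (Var 0) (Var 1)" "\<lambda>n. if n = 0 then s else t"] by simp
  have cls_iff: "M.cls (P s) = M.cls (P t) \<longleftrightarrow> N.cls (Q s) = N.cls (Q t)" for s t
    using M.cls_eq_iff[OF Pm Pm] N.cls_eq_iff[OF Qm Qm] dist by simp
  \<comment> \<open>Any coordinate representing the class may be chosen, by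
    \<open>cls_iff\<close>.\<close>
  define h where "h = (\<lambda>A. N.cls (Q (SOME t. M.cls (P t) = A)))"
  have h: "h (M.cls (P t)) = N.cls (Q t)" for t
  proof -
    have "M.cls (P (SOME s. M.cls (P s) = M.cls (P t))) = M.cls (P t)" by (rule someI) (rule refl)
    then show ?thesis unfolding h_def using cls_iff by blast
  qed
  have carM: "str_carrier M.PM = range (\<lambda>t. M.cls (P t))"
    by (simp add: M.powermean_carrier P[symmetric] image_image)
  have carN: "str_carrier N.PM = range (\<lambda>t. N.cls (Q t))"
    by (simp add: N.powermean_carrier Q[symmetric] image_image)
  have tuple: "\<exists>ts. length ts = k \<and> As = map (\<lambda>t. M.cls (P t)) ts" if "As \<in> tuples (str_carrier M.PM) k" for As k
  proof -
    have "As \<in> lists (range (\<lambda>t. M.cls (P t)))" "length As = k"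
      using that by (auto simp: tuples_def carM)
    then show ?thesis by (auto simp: lists_image)
  qed
  have hmap: "map h (map (\<lambda>t. M.cls (P t)) ts) = map N.cls (map Q ts)" for ts by (simp add: h)
  have Mmap: "map (\<lambda>t. M.cls (P t)) ts = map M.cls (map P ts)" for ts by simp
  have sP: "set (map P ts) \<subseteq> M.maps" and sQ: "set (map Q ts) \<subseteq> N.maps" for ts using Pm Qm by auto
  \<comment> \<open>For constants and functions: the value in \<open>M\<close> occurs as some
    \<open>P t\<close>, and it remains to see that \<open>Q t\<close> has distance zero from the
    value in \<open>N\<close>.\<close>
  have hP: "h (M.cls a) = N.cls b"
    if a: "a \<in> M.maps" and b: "b \<in> N.maps"
      and ab: "\<And>t. P t = a \<Longrightarrow> L (N.dp (Q t) b) = 0" for a b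
  proof -
    obtain t where t: "P t = a" using a P by (metis imageE)
    then have "h (M.cls a) = N.cls (Q t)" using h by blast
    also have "\<dots> = N.cls b" using N.cls_eq_iff[OF Qm b] ab[OF t] by blast
    finally show ?thesis .
  qed
  have self: "L (M.dp a a) = 0" if "a \<in> M.maps" for a using M.rel_refl[OF that] by (simp add: M.rel_iff)
  have "struct_iso \<tau> M.PM N.PM h"
    unfolding struct_iso_def
  proof (intro conjI ballI)
    show "bij_betw h (str_carrier M.PM) (str_carrier N.PM)"
      unfolding bij_betw_def carM carN
      by (auto simp: inj_on_def h cls_iff image_image)
  next
    fix A B assume "A \<in> str_carrier M.PM" "B \<in> str_carrier M.PM"
    then show "str_dist N.PM (h A) (h B) = str_dist M.PM A B"
      by (auto simp: carM h M.powermean_dist[OF Pm Pm] N.powermean_dist[OF Qm Qm] dist)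
  next
    fix c assume c: "c \<in> sig_consts \<tau>"
    show "h (str_const M.PM c) = str_const N.PM c"
      unfolding M.powermean_const N.powermean_const
    proof (rule hP)
      show cm: "(\<lambda>i. str_const M c) \<in> M.maps"
        using M.maps_comp[of "[]" "\<lambda>_. str_const M c"] structure_onD(4)[OF M.M c] by simp
      show "(\<lambda>i. str_const N c) \<in> N.maps"
        using N.maps_comp[of "[]" "\<lambda>_. str_const N c"] structure_onD(4)[OF N.M c] by simp
      fix t assume "P t = (\<lambda>i. str_const M c)"
      then show "L (N.dp (Q t) (\<lambda>i. str_const N c)) = 0"
        using bal[of "DistP (Var 0) (Cst c)" "\<lambda>n. t"] self[OF cm] c by simp
    qed
  next
    fix F As assume F: "F \<in> sig_funs \<tau>" and "As \<in> tuples (str_carrier M.PM) (fun_arity \<tau> F)"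
    then obtain ts where ts: "length ts = fun_arity \<tau> F" "As = map (\<lambda>t. M.cls (P t)) ts"
      using tuple by blast
    have lP: "length (map P ts) = fun_arity \<tau> F" and lQ: "length (map Q ts) = fun_arity \<tau> F"
      using ts by auto
    show "h (str_fun M.PM F As) = str_fun N.PM F (map h As)"
      unfolding ts(2) hmap unfolding Mmap M.powermean_fun[OF F sP lP] N.powermean_fun[OF F sQ lQ]
    proof (rule hP[OF M.str_fun_maps[OF F sP lP] N.str_fun_maps[OF F sQ lQ]])
      fix t assume t: "P t = (\<lambda>i. str_fun M F (map (\<lambda>a. a i) (map P ts)))"
      \<comment> \<open>Variable 0 carries the value and the later variables the arguments, so the
        atomic formula below integrates the distance from the graph of \<open>F\<close>.\<close>
      let ?\<sigma> = "\<lambda>n. case n of 0 \<Rightarrow> t | Suc k \<Rightarrow> ts ! k"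
      let ?vs = "map (\<lambda>k. Var (Suc k)) [0..<length ts]"
      have MF: "map (trm_val M (\<lambda>n. P (?\<sigma> n) i)) ?vs = map (\<lambda>a. a i) (map P ts)" for i
        by (rule nth_equalityI) auto
      have NF: "map (trm_val N (\<lambda>n. Q (?\<sigma> n) i)) ?vs = map (\<lambda>a. a i) (map Q ts)" for i
        by (rule nth_equalityI) auto
      have "L (M.dp (P t) (\<lambda>i. str_fun M F (map (\<lambda>a. a i) (map P ts))))
        = L (N.dp (Q t) (\<lambda>i. str_fun N F (map (\<lambda>a. a i) (map Q ts))))"
        using bal[of "DistP (Var 0) (App F ?vs)" ?\<sigma>] F ts(1)
        unfolding fm_val.simps trm_val.simps MF NF by simp
      then show "L (N.dp (Q t) (\<lambda>i. str_fun N F (map (\<lambda>a. a i) (map Q ts)))) = 0"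
        using self[OF Pm, of t] unfolding t by simp
    qed
  next
    fix R As assume R: "R \<in> sig_rels \<tau>" and "As \<in> tuples (str_carrier M.PM) (rel_arity \<tau> R)"
    then obtain ts where ts: "length ts = rel_arity \<tau> R" "As = map (\<lambda>t. M.cls (P t)) ts"
      using tuple by blast
    have lP: "length (map P ts) = rel_arity \<tau> R" and lQ: "length (map Q ts) = rel_arity \<tau> R"
      using ts by auto
    let ?\<sigma> = "\<lambda>k. ts ! k"
    let ?vs = "map Var [0..<length ts]"
    have MF: "map (trm_val M (\<lambda>n. P (?\<sigma> n) i)) ?vs = map (\<lambda>a. a i) (map P ts)" for i
      by (rule nth_equalityI) auto
    have NF: "map (trm_val N (\<lambda>n. Q (?\<sigma> n) i)) ?vs = map (\<lambda>a. a i) (map Q ts)" for i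
      by (rule nth_equalityI) auto
    show "str_rel N.PM R (map h As) = str_rel M.PM R As"
      unfolding ts(2) hmap unfolding Mmap M.powermean_rel[OF R sP lP] N.powermean_rel[OF R sQ lQ]
      using bal[of "Rel R ?vs" ?\<sigma>] R ts(1)
      unfolding fm_val.simps trm_val.simps MF NF by simp
  qed
  then show ?thesis unfolding isomorphic_structs_def by blast
qed

section \<open>Maps depending on few coordinates\<close>

text \<open>The enumeration \<open>c\<close> may repeat, so this says that \<open>f\<close> is
  determined by at most |base| many coordinates.\<close>

definition few :: "('i \<Rightarrow> ('a, 'b) coord \<Rightarrow> 'a \<times> 'b) \<Rightarrow> ('i \<Rightarrow> 'y) \<Rightarrow> bool" where
  "few pr f \<longleftrightarrow> (\<exists>c :: ('a, 'b) base \<Rightarrow> ('a, 'b) coord.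
     \<forall>i j. (\<forall>u. pr i (c u) = pr j (c u)) \<longrightarrow> f i = f j)"

definition few_sets :: "('i \<Rightarrow> ('a, 'b) coord \<Rightarrow> 'a \<times> 'b) \<Rightarrow> 'i set set" where
  "few_sets pr = {A. few pr (\<lambda>i. i \<in> A)}"

lemma few_const: "few pr (\<lambda>_. y)"
  by (simp add: few_def)

lemma few_comp:
  fixes pr :: "'i \<Rightarrow> ('a, 'b) coord \<Rightarrow> 'a \<times> 'b"
  assumes "few pr f" shows "few pr (\<lambda>i. g (f i))"
proof -
  obtain c :: "('a, 'b) base \<Rightarrow> ('a, 'b) coord" where
    "\<forall>i j. (\<forall>u. pr i (c u) = pr j (c u)) \<longrightarrow> f i = f j"
    using assms unfolding few_def by (elim exE)
  then have "\<forall>i j. (\<forall>u. pr i (c u) = pr j (c u)) \<longrightarrow> g (f i) = g (f j)" by metis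
  then show ?thesis unfolding few_def by blast
qed

lemma few_coord: "few pr (\<lambda>i. pr i t)"
  unfolding few_def by (rule exI[of _ "\<lambda>_. t"]) simp

text \<open>Base-many enumerations of base-many coordinates are merged into one by
  \<open>\<pi>\<close>. This is the source of the completeness of the algebra.\<close>

lemma few_family:
  fixes pr :: "'i \<Rightarrow> ('a, 'b) coord \<Rightarrow> 'a \<times> 'b" and f :: "('a, 'b) base \<Rightarrow> 'i \<Rightarrow> 'y"
  assumes "\<And>u. few pr (f u)"
  shows "few pr (\<lambda>i u. f u i)"
proof -
  obtain \<pi> :: "('a, 'b) base \<Rightarrow> ('a, 'b) base \<times> ('a, 'b) base" where \<pi>: "surj \<pi>"
    using base_pairing_exists by blast
  have "\<forall>u. \<exists>c :: ('a, 'b) base \<Rightarrow> ('a, 'b) coord. \<forall>i j. (\<forall>v. pr i (c v) = pr j (c v)) \<longrightarrow> f u i = f u j"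
    using assms by (simp add: few_def)
  from choice[OF this] obtain c :: "('a, 'b) base \<Rightarrow> ('a, 'b) base \<Rightarrow> ('a, 'b) coord" where
    c: "\<forall>u i j. (\<forall>v. pr i (c u v) = pr j (c u v)) \<longrightarrow> f u i = f u j" ..
  show ?thesis
    unfolding few_def
  proof (intro exI[of _ "\<lambda>x. c (fst (\<pi> x)) (snd (\<pi> x))"] allI impI ext)
    fix i j u
    assume *: "\<forall>x. pr i (c (fst (\<pi> x)) (snd (\<pi> x))) = pr j (c (fst (\<pi> x)) (snd (\<pi> x)))"
    have "pr i (c u v) = pr j (c u v)" for v
    proof -
      obtain x where "\<pi> x = (u, v)" using \<pi> by (metis surjD)
      then show ?thesis using *[rule_format, of x] by simp
    qed
    then show "f u i = f u j" using c by blast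
  qed
qed

text \<open>The entries are placed in a family at the indices \<open>Inl n\<close>, which is
  possible because \<open>base\<close> contains \<open>nat\<close>.\<close>

lemma few_list:
  fixes pr :: "'i \<Rightarrow> ('a, 'b) coord \<Rightarrow> 'a \<times> 'b" and as :: "('i \<Rightarrow> 'y) list"
  assumes "\<And>a. a \<in> set as \<Longrightarrow> few pr a"
  shows "few pr (\<lambda>i. map (\<lambda>a. a i) as)"
proof -
  define f :: "('a, 'b) base \<Rightarrow> 'i \<Rightarrow> 'y" where
    "f u = (case u of Inl n \<Rightarrow> if n < length as then as ! n else (\<lambda>_. undefined) | _ \<Rightarrow> (\<lambda>_. undefined))"
    for u
  have "few pr (f u)" for u
    unfolding f_def using assms by (auto simp: few_const split: sum.split)
  then have "few pr (\<lambda>i u. f u i)" by (rule few_family)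
  from few_comp[OF this, of "\<lambda>w. map (\<lambda>n. w (Inl n)) [0..<length as]"]
  have "few pr (\<lambda>i. map (\<lambda>n. f (Inl n) i) [0..<length as])" .
  moreover have "map (\<lambda>n. f (Inl n) i) [0..<length as] = map (\<lambda>a. a i) as" for i
    by (rule nth_equalityI) (auto simp: f_def)
  ultimately show ?thesis by simp
qed

text \<open>As \<open>'y\<close> has at most |base| many points, the value of \<open>a\<close> can
  be decoded from base-many truth values, one for each fibre.\<close>

lemma few_of_fibres:
  fixes pr :: "'i \<Rightarrow> ('a, 'b) coord \<Rightarrow> 'a \<times> 'b" and e :: "('a, 'b) base \<Rightarrow> 'y"
    and a :: "'i \<Rightarrow> 'y"
  assumes "surj e" "\<And>x. few pr (\<lambda>i. a i = x)"
  shows "few pr a"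
proof -
  have "few pr (\<lambda>i u. a i = e u)" by (rule few_family) (rule assms(2))
  from few_comp[OF this, of "\<lambda>w. THE x. \<forall>u. w u \<longleftrightarrow> x = e u"]
  have "few pr (\<lambda>i. THE x. \<forall>u. (a i = e u) = (x = e u))" .
  moreover have "(THE x. \<forall>u. (a i = e u) = (x = e u)) = a i" for i
  proof (rule the_equality)
    fix x assume *: "\<forall>u. (a i = e u) = (x = e u)"
    obtain u where "x = e u" using assms(1) by (rule surjE)
    then show "x = a i" using *[rule_format, of u] by simp
  qed simp
  ultimately show ?thesis by simp
qed

lemma few_sets_vimage: "few pr f \<Longrightarrow> f -` X \<in> few_sets pr"
  by (simp add: few_sets_def few_comp[of _ _ "\<lambda>y. y \<in> X"])

lemma few_sets_UN:
  fixes A :: "('a, 'b) base \<Rightarrow> 'i set" and pr :: "'i \<Rightarrow> ('a, 'b) coord \<Rightarrow> 'a \<times> 'b"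
  assumes "\<And>u. A u \<in> few_sets pr"
  shows "(\<Union>u. A u) \<in> few_sets pr"
proof -
  have "few pr (\<lambda>i u. i \<in> A u)"
    by (rule few_family) (use assms in \<open>simp add: few_sets_def\<close>)
  from few_comp[OF this, of "\<lambda>w. \<exists>u. w u"] show ?thesis by (simp add: few_sets_def)
qed

lemma algebra_few_sets:
  fixes pr :: "'i \<Rightarrow> ('a, 'b) coord \<Rightarrow> 'a \<times> 'b"
  shows "algebra UNIV (few_sets pr)"
  unfolding algebra_iff_Un
proof (intro conjI ballI)
  show "{} \<in> few_sets pr" by (simp add: few_sets_def few_const)
next
  fix A assume "A \<in> few_sets pr"
  then show "UNIV - A \<in> few_sets pr"
    using few_comp[of pr "\<lambda>i. i \<in> A" Not] by (simp add: few_sets_def)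
next
  fix A B assume AB: "A \<in> few_sets pr" "B \<in> few_sets pr"
  have "(\<Union>u :: ('a, 'b) base. if u = Inl 0 then A else B) \<in> few_sets pr"
    by (rule few_sets_UN) (use AB in simp)
  moreover have "(\<Union>u :: ('a, 'b) base. if u = Inl 0 then A else B) = A \<union> B"
    by (auto split: if_splits)
  ultimately show "A \<union> B \<in> few_sets pr" by simp
qed simp

lemma union_complete_few_sets:
  fixes e :: "('a, 'b) base \<Rightarrow> 'm" and pr :: "'i \<Rightarrow> ('a, 'b) coord \<Rightarrow> 'a \<times> 'b"
  assumes "surj e"
  shows "union_complete |UNIV :: 'm set| (few_sets pr)"
  unfolding union_complete_def
proof (intro allI impI)
  fix \<F> assume F: "\<F> \<subseteq> few_sets pr \<and> |\<F>| \<le>o |UNIV :: 'm set|"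
  show "\<Union>\<F> \<in> few_sets pr"
  proof (cases "\<F> = {}")
    case True
    then show ?thesis by (simp add: few_sets_def few_const)
  next
    case False
    then obtain g :: "'m \<Rightarrow> 'i set" where g: "range g = \<F>"
      using F card_of_ordLeq2[OF False, of "UNIV :: 'm set"] by blast
    have "(\<Union>u. g (e u)) \<in> few_sets pr"
      by (rule few_sets_UN) (use F g in blast)
    moreover have "range (\<lambda>u. g (e u)) = \<F>"
      using assms g by (metis image_image)
    ultimately show ?thesis by simp
  qed
qed

lemma meanable_few_sets:
  fixes M :: "('m, 'f, 'r, 'c) struct" and e :: "('a, 'b) base \<Rightarrow> 'm"
    and pr :: "'i \<Rightarrow> ('a, 'b) coord \<Rightarrow> 'a \<times> 'b"
  assumes "structure_on p \<tau> M" "surj e"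
  shows "meanable (few_sets pr) M"
proof -
  interpret Metric_space "str_carrier M" "str_dist M" by (rule structure_onD(1)[OF assms(1)])
  have "str_topology M closure_of str_carrier M = str_carrier M"
    using closure_of_topspace[of mtopology] by (simp add: str_topology_def)
  moreover have "|str_carrier M| \<le>o |UNIV :: 'm set|" by (rule card_of_mono1) simp
  ultimately show ?thesis
    unfolding meanable_def
    using union_complete_few_sets[OF assms(2), of pr] card_of_Card_order by blast
qed

lemma singleton_str_borel:
  assumes "structure_on p \<tau> M" "x \<in> str_carrier M"
  shows "{x} \<in> str_borel M"
proof -
  interpret Metric_space "str_carrier M" "str_dist M" by (rule structure_onD(1)[OF assms(1)])
  have "closedin mtopology {x}"
    using closedin_Hausdorff_singleton[OF Hausdorff_space_mtopology, of x] assms(2) by simp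
  then have "str_carrier M - {x} \<in> {U. openin (str_topology M) U}"
    by (simp add: closedin_def str_topology_def)
  then have "str_carrier M - (str_carrier M - {x}) \<in> str_borel M"
    unfolding str_borel_def by (intro sigma_sets.Compl sigma_sets.Basic)
  moreover have "str_carrier M - (str_carrier M - {x}) = {x}" using assms(2) by blast
  ultimately show ?thesis by simp
qed

text \<open>Singletons are closed, so measurability makes every fibre depend on few coordinates, and
  hence the map itself. Conversely all preimages under such a map lie in the algebra, Borel or
  not.\<close>

lemma meas_maps_few_sets:
  fixes M :: "('m, 'f, 'r, 'c) struct" and e :: "('a, 'b) base \<Rightarrow> 'm"
    and pr :: "'i \<Rightarrow> ('a, 'b) coord \<Rightarrow> 'a \<times> 'b"
  assumes M: "structure_on p \<tau> M" and e: "surj e"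
  shows "meas_maps UNIV (few_sets pr) M = {a. (\<forall>i. a i \<in> str_carrier M) \<and> few pr a}"
proof (intro equalityI subsetI CollectI conjI)
  fix a assume a: "a \<in> meas_maps UNIV (few_sets pr) M"
  then show c: "\<forall>i. a i \<in> str_carrier M" by (auto simp: meas_maps_def)
  have "few pr (\<lambda>i. a i = x)" for x
  proof (cases "x \<in> str_carrier M")
    case True
    then have "a -` {x} \<in> few_sets pr"
      using a singleton_str_borel[OF M True] by (auto simp: meas_maps_def)
    then show ?thesis by (simp add: few_sets_def)
  next
    case False
    then have "(\<lambda>i. a i = x) = (\<lambda>i. False)" using c by auto
    then show ?thesis by (simp add: few_const)
  qed
  then show "few pr a" by (rule few_of_fibres[OF e])
next
  fix a assume "a \<in> {a. (\<forall>i. a i \<in> str_carrier M) \<and> few pr a}"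
  then show "a \<in> meas_maps UNIV (few_sets pr) M"
    by (auto simp: meas_maps_def PiE_UNIV_domain few_sets_vimage)
qed

lemma mean_structure_few_sets:
  fixes M :: "('m, 'f, 'r, 'c) struct" and e :: "('a, 'b) base \<Rightarrow> 'm"
    and pr :: "'i \<Rightarrow> ('a, 'b) coord \<Rightarrow> 'a \<times> 'b"
  assumes "1 \<le> p" "wf_signature \<tau>" "structure_on p \<tau> M" "mean L" "surj e"
  shows "mean_structure p \<tau> M L (few_sets pr)"
proof
  fix as :: "('i \<Rightarrow> 'm) list" and X
  assume "set as \<subseteq> meas_maps UNIV (few_sets pr) M"
  then have "few pr a" if "a \<in> set as" for a
    using that meas_maps_few_sets[OF assms(3,5), of pr] by blast
  then show "(\<lambda>i. map (\<lambda>a. a i) as) -` X \<in> few_sets pr"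
    by (intro few_sets_vimage few_list)
qed (use assms in auto)

lemma charge_space_mean_charge:
  assumes "mean L" "algebra UNIV \<A>"
  shows "charge_space UNIV \<A> (mean_charge L)"
proof -
  have b: "bounded (range (indicator X :: _ \<Rightarrow> real))" for X
    by (auto simp: bounded_range_iff indicator_def)
  have "mean_charge L (X \<union> Y) = mean_charge L X + mean_charge L Y" if "X \<inter> Y = {}" for X Y
  proof -
    have "(indicator (X \<union> Y) :: _ \<Rightarrow> real) = (\<lambda>i. indicator X i + indicator Y i)"
      using that by (auto simp: indicator_def fun_eq_iff)
    then show ?thesis using mean_add[OF assms(1) b b] by simp
  qed
  moreover have "(indicator UNIV :: _ \<Rightarrow> real) = (\<lambda>_. 1)" by (simp add: fun_eq_iff)
  then have "mean_charge L UNIV = 1" using mean_const[OF assms(1)] by simp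
  moreover have "0 \<le> mean_charge L X" for X by (rule mean_nonneg[OF assms(1) b]) simp
  ultimately show ?thesis using assms(2) by (simp add: charge_space_def)
qed

section \<open>The two components of a coordinate\<close>

text \<open>A label \<open>Inl f\<close> prescribes the left component and leaves the right one
  free; \<open>Inr g\<close> does the opposite. Labels are arbitrary functions into the type, so
  values outside the carrier are replaced by the default. A \<open>Leaf\<close> has a free left
  component and a constant right one.\<close>

primrec left_comp :: "'a set \<Rightarrow> 'a \<Rightarrow> ('i \<Rightarrow> ('a, 'b) coord \<Rightarrow> 'a \<times> 'b) \<Rightarrow> ('a, 'b) coord \<Rightarrow> 'i \<Rightarrow> 'a" where
  "left_comp X x pr Leaf = (\<lambda>i. fst (pr i Leaf))"
| "left_comp X x pr (Node l c) = (\<lambda>i. case l of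
     Inl f \<Rightarrow> if f (\<lambda>u. pr i (c u)) \<in> X then f (\<lambda>u. pr i (c u)) else x
   | Inr g \<Rightarrow> fst (pr i (Node l c)))"

primrec right_comp :: "'b set \<Rightarrow> 'b \<Rightarrow> ('i \<Rightarrow> ('a, 'b) coord \<Rightarrow> 'a \<times> 'b) \<Rightarrow> ('a, 'b) coord \<Rightarrow> 'i \<Rightarrow> 'b" where
  "right_comp Y y pr Leaf = (\<lambda>i. y)"
| "right_comp Y y pr (Node l c) = (\<lambda>i. case l of
     Inl f \<Rightarrow> snd (pr i (Node l c))
   | Inr g \<Rightarrow> if g (\<lambda>u. pr i (c u)) \<in> Y then g (\<lambda>u. pr i (c u)) else y)"

lemma few_children:
  fixes pr :: "'i \<Rightarrow> ('a, 'b) coord \<Rightarrow> 'a \<times> 'b" and c :: "('a, 'b) base \<Rightarrow> ('a, 'b) coord"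
  shows "few pr (\<lambda>i. g (\<lambda>u. pr i (c u)))"
proof -
  have "few pr (\<lambda>i u. pr i (c u))" by (rule few_family) (rule few_coord)
  then show ?thesis by (rule few_comp)
qed

lemma few_comps: "few pr (left_comp X x pr t)" "few pr (right_comp Y y pr t)"
proof -
  show "few pr (left_comp X x pr t)"
  proof (cases t)
    case Leaf
    then show ?thesis using few_comp[OF few_coord, of pr fst Leaf] by simp
  next
    case (Node l c)
    then show ?thesis
      using few_comp[OF few_coord, of pr fst t]
        few_children[of pr "\<lambda>w. if f w \<in> X then f w else x" c for f]
      by (cases l) simp_all
  qed
  show "few pr (right_comp Y y pr t)"
  proof (cases t)
    case Leaf
    then show ?thesis by (simp add: few_const)
  next
    case (Node l c)
    then show ?thesis
      using few_comp[OF few_coord, of pr snd t]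
        few_children[of pr "\<lambda>w. if f w \<in> Y then f w else y" c for f]
      by (cases l) simp_all
  qed
qed

text \<open>The function \<open>f\<close> found here becomes the label of a node: it evaluates
  \<open>a\<close> at any index showing the given values at the coordinates
  \<open>c\<close>.\<close>

lemma few_factor:
  fixes pr :: "'i \<Rightarrow> ('a, 'b) coord \<Rightarrow> 'a \<times> 'b"
  assumes "few pr a"
  shows "\<exists>(c :: ('a, 'b) base \<Rightarrow> ('a, 'b) coord) f. \<forall>i. f (\<lambda>u. pr i (c u)) = a i"
proof -
  obtain c :: "('a, 'b) base \<Rightarrow> ('a, 'b) coord" where
    c: "\<forall>i j. (\<forall>u. pr i (c u) = pr j (c u)) \<longrightarrow> a i = a j"
    using assms unfolding few_def by (elim exE)
  define f where "f = (\<lambda>w. a (SOME j. (\<lambda>u. pr j (c u)) = w))"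
  have "f (\<lambda>u. pr i (c u)) = a i" for i
  proof -
    have "(\<lambda>u. pr (SOME j. (\<lambda>u. pr j (c u)) = (\<lambda>u. pr i (c u))) (c u)) = (\<lambda>u. pr i (c u))"
      by (rule someI) (rule refl)
    then show ?thesis unfolding f_def using c by (metis (mono_tags))
  qed
  then show ?thesis by blast
qed

text \<open>A map \<open>a\<close> that factors as \<open>f\<close> through the coordinates
  \<open>c\<close> is the left component of \<open>Node (Inl f) c\<close>. Each map is thus caught
  by a node placed directly above the coordinates it depends on.\<close>

lemma range_left_comp:
  fixes pr :: "'i \<Rightarrow> ('a, 'b) coord \<Rightarrow> 'a \<times> 'b"
  assumes "\<And>i t. fst (pr i t) \<in> X" "x \<in> X"
  shows "range (left_comp X x pr) = {a. (\<forall>i. a i \<in> X) \<and> few pr a}"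
proof (intro equalityI subsetI)
  fix a assume "a \<in> range (left_comp X x pr)"
  then obtain t where t: "a = left_comp X x pr t" by blast
  have "left_comp X x pr t i \<in> X" for i using assms by (cases t) (auto split: sum.split)
  then show "a \<in> {a. (\<forall>i. a i \<in> X) \<and> few pr a}" by (simp add: t few_comps)
next
  fix a assume a: "a \<in> {a. (\<forall>i. a i \<in> X) \<and> few pr a}"
  then have "few pr a" by blast
  from few_factor[OF this] obtain c :: "('a, 'b) base \<Rightarrow> ('a, 'b) coord" and f where
    "\<forall>i. f (\<lambda>u. pr i (c u)) = a i" by (elim exE)
  then have "a = left_comp X x pr (Node (Inl f) c)" using a by (auto simp: fun_eq_iff)
  then show "a \<in> range (left_comp X x pr)" by blast
qed

lemma range_right_comp:
  fixes pr :: "'i \<Rightarrow> ('a, 'b) coord \<Rightarrow> 'a \<times> 'b"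
  assumes "\<And>i t. snd (pr i t) \<in> Y" "y \<in> Y"
  shows "range (right_comp Y y pr) = {a. (\<forall>i. a i \<in> Y) \<and> few pr a}"
proof (intro equalityI subsetI)
  fix a assume "a \<in> range (right_comp Y y pr)"
  then obtain t where t: "a = right_comp Y y pr t" by blast
  have "right_comp Y y pr t i \<in> Y" for i using assms by (cases t) (auto split: sum.split)
  then show "a \<in> {a. (\<forall>i. a i \<in> Y) \<and> few pr a}" by (simp add: t few_comps)
next
  fix a assume a: "a \<in> {a. (\<forall>i. a i \<in> Y) \<and> few pr a}"
  then have "few pr a" by blast
  from few_factor[OF this] obtain c :: "('a, 'b) base \<Rightarrow> ('a, 'b) coord" and f where
    "\<forall>i. f (\<lambda>u. pr i (c u)) = a i" by (elim exE)
  then have "a = right_comp Y y pr (Node (Inr f) c)" using a by (auto simp: fun_eq_iff)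
  then show "a \<in> range (right_comp Y y pr)" by blast
qed

text \<open>The components of \<open>s\<close> read the raw values only at \<open>s\<close> and at
  the children of \<open>s\<close>.\<close>

lemma comps_indep:
  assumes "\<And>r. r \<noteq> t \<Longrightarrow> pr j r = pr i r" "s \<noteq> t" "(t, s) \<notin> child"
  shows "left_comp X x pr s j = left_comp X x pr s i" "right_comp Y y pr s j = right_comp Y y pr s i"
proof -
  have "(\<lambda>u. pr j (c u)) = (\<lambda>u. pr i (c u))" if "s = Node l c" for l c
  proof
    fix u have "c u \<noteq> t" using assms(3) that by (auto simp: child_def)
    then show "pr j (c u) = pr i (c u)" by (rule assms(1))
  qed
  moreover have "pr j s = pr i s" using assms(1,2) by blast
  ultimately show "left_comp X x pr s j = left_comp X x pr s i"
    "right_comp Y y pr s j = right_comp Y y pr s i"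
    by (cases s; auto split: sum.split)+
qed

text \<open>Of the two components of a coordinate, one can be chosen freely, without changing the other
  one and the components of any coordinate that is not its parent.\<close>

lemma comps_free:
  fixes pr :: "'i \<Rightarrow> ('a, 'b) coord \<Rightarrow> 'a \<times> 'b"
  assumes pr: "range pr = {w. \<forall>t. w t \<in> X \<times> Y}"
  shows "(\<forall>i. \<forall>b\<in>Y. \<exists>j. right_comp Y y pr t j = b \<and> left_comp X x pr t j = left_comp X x pr t i \<and>
        (\<forall>s. s \<noteq> t \<longrightarrow> (t, s) \<notin> child \<longrightarrow>
          left_comp X x pr s j = left_comp X x pr s i \<and> right_comp Y y pr s j = right_comp Y y pr s i)) \<or>
      (\<forall>i. \<forall>a\<in>X. \<exists>j. left_comp X x pr t j = a \<and> right_comp Y y pr t j = right_comp Y y pr t i \<and>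
        (\<forall>s. s \<noteq> t \<longrightarrow> (t, s) \<notin> child \<longrightarrow>
          left_comp X x pr s j = left_comp X x pr s i \<and> right_comp Y y pr s j = right_comp Y y pr s i))"
proof -
  have in_XY: "pr i r \<in> X \<times> Y" for i r using pr by blast
  have move: "\<exists>j. pr j = (pr i)(t := (a, b))" if "a \<in> X" "b \<in> Y" for i a b
  proof -
    have "(pr i)(t := (a, b)) \<in> range pr" unfolding pr using that in_XY by auto
    then show ?thesis by (metis imageE)
  qed
  have indep: "\<forall>s. s \<noteq> t \<longrightarrow> (t, s) \<notin> child \<longrightarrow>
      left_comp X x pr s j = left_comp X x pr s i \<and> right_comp Y y pr s j = right_comp Y y pr s i"
    if "pr j = (pr i)(t := z)" for i j z
    using comps_indep[of t pr j i] that by simp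
  \<comment> \<open>Since \<open>t\<close> is not its own child, overwriting the raw value at
    \<open>t\<close> leaves the argument of its label, and with it the prescribed component,
    unchanged.\<close>
  have below: "(\<lambda>u. pr j (c u)) = (\<lambda>u. pr i (c u))" if "pr j = (pr i)(t := z)" "t = Node l c" for i j z l c
  proof
    fix u have "(c u, t) \<in> child" using that(2) by (auto simp: child_def)
    then have "c u \<noteq> t" using wf_not_refl[OF wf_child] by metis
    then show "pr j (c u) = pr i (c u)" using that(1) by simp
  qed
  consider "t = Leaf" | f c where "t = Node (Inl f) c" | g c where "t = Node (Inr g) c"
    by (metis sum.exhaust tree.exhaust)
  then show ?thesis
  proof cases
    case (2 f c)
    show ?thesis
    proof (rule disjI1, intro allI ballI)
      fix i b assume "b \<in> Y"
      then obtain j where j: "pr j = (pr i)(t := (fst (pr i t), b))"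
        using move[of "fst (pr i t)" b i] in_XY[of i t] by (auto simp: mem_Times_iff)
      have "right_comp Y y pr t j = b" using 2 j by simp
      moreover have "left_comp X x pr t j = left_comp X x pr t i"
        using below[OF j 2] 2 by simp
      ultimately show "\<exists>j. right_comp Y y pr t j = b \<and> left_comp X x pr t j = left_comp X x pr t i \<and>
        (\<forall>s. s \<noteq> t \<longrightarrow> (t, s) \<notin> child \<longrightarrow>
          left_comp X x pr s j = left_comp X x pr s i \<and> right_comp Y y pr s j = right_comp Y y pr s i)"
        using indep[OF j] by blast
    qed
  next
    case 1
    show ?thesis
    proof (rule disjI2, intro allI ballI)
      fix i a assume "a \<in> X"
      then obtain j where j: "pr j = (pr i)(t := (a, snd (pr i t)))"
        using move[of a "snd (pr i t)" i] in_XY[of i t] by (auto simp: mem_Times_iff)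
      have "left_comp X x pr t j = a" "right_comp Y y pr t j = right_comp Y y pr t i"
        using 1 j by simp_all
      then show "\<exists>j. left_comp X x pr t j = a \<and> right_comp Y y pr t j = right_comp Y y pr t i \<and>
        (\<forall>s. s \<noteq> t \<longrightarrow> (t, s) \<notin> child \<longrightarrow>
          left_comp X x pr s j = left_comp X x pr s i \<and> right_comp Y y pr s j = right_comp Y y pr s i)"
        using indep[OF j] by blast
    qed
  next
    case (3 g c)
    show ?thesis
    proof (rule disjI2, intro allI ballI)
      fix i a assume "a \<in> X"
      then obtain j where j: "pr j = (pr i)(t := (a, snd (pr i t)))"
        using move[of a "snd (pr i t)" i] in_XY[of i t] by (auto simp: mem_Times_iff)
      have "left_comp X x pr t j = a" using 3 j by simp
      moreover have "right_comp Y y pr t j = right_comp Y y pr t i"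
        using below[OF j 3] 3 by simp
      ultimately show "\<exists>j. left_comp X x pr t j = a \<and> right_comp Y y pr t j = right_comp Y y pr t i \<and>
        (\<forall>s. s \<noteq> t \<longrightarrow> (t, s) \<notin> child \<longrightarrow>
          left_comp X x pr s j = left_comp X x pr s i \<and> right_comp Y y pr s j = right_comp Y y pr s i)"
        using indep[OF j] by blast
    qed
  qed
qed

section \<open>The balanced mean and the final assembly\<close>

lemma balanced_mean_exists:
  fixes P :: "'t \<Rightarrow> 'i \<Rightarrow> 'a" and Q :: "'t \<Rightarrow> 'i \<Rightarrow> 'b"
    and \<tau> :: "('f, 'r, 'c) signature" and M :: "('a, 'f, 'r, 'c) struct" and N :: "('b, 'f, 'r, 'c) struct"
  assumes M: "structure_on p \<tau> M" and N: "structure_on p \<tau> N" and p: "1 \<le> p"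
    and P: "\<And>t i. P t i \<in> str_carrier M" and Q: "\<And>t i. Q t i \<in> str_carrier N"
    and gap: "\<And>(\<phi> :: ('f, 'r, 'c) fm) \<sigma> e. wf_fm \<tau> \<phi> \<Longrightarrow> qf \<phi> \<Longrightarrow> 0 < e \<Longrightarrow>
      \<exists>i. fm_val p M \<phi> (\<lambda>n. P (\<sigma> n) i) - fm_val p N \<phi> (\<lambda>n. Q (\<sigma> n) i) < e"
  shows "\<exists>L. mean L \<and> (\<forall>(\<phi> :: ('f, 'r, 'c) fm) \<sigma>. wf_fm \<tau> \<phi> \<longrightarrow> qf \<phi> \<longrightarrow>
      L (\<lambda>i. fm_val p M \<phi> (\<lambda>n. P (\<sigma> n) i)) = L (\<lambda>i. fm_val p N \<phi> (\<lambda>n. Q (\<sigma> n) i)))"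
proof -
  define v where "v = (\<lambda>(\<phi> :: ('f, 'r, 'c) fm) \<sigma> i. fm_val p M \<phi> (\<lambda>n. P (\<sigma> n) i) - fm_val p N \<phi> (\<lambda>n. Q (\<sigma> n) i))"
  define V where "V = {v \<phi> \<sigma> |\<phi> \<sigma>. wf_fm \<tau> \<phi> \<and> qf \<phi>}"
  have bd: "bounded (range (\<lambda>i. fm_val p M \<phi> (\<lambda>n. P (\<sigma> n) i)))"
    "bounded (range (\<lambda>i. fm_val p N \<phi> (\<lambda>n. Q (\<sigma> n) i)))" if "wf_fm \<tau> \<phi>" for \<phi> :: "('f, 'r, 'c) fm" and \<sigma>
    unfolding bounded_range_iff
    using fm_val_bounded[OF M p that] fm_val_bounded[OF N p that] P Q by metis+
  have "\<exists>L. mean L \<and> (\<forall>w\<in>V. L w = 0)"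
  proof (rule mean_exists)
    fix w assume "w \<in> V"
    then obtain \<phi> \<sigma> where w: "w = v \<phi> \<sigma>" "wf_fm \<tau> \<phi>" "qf \<phi>" unfolding V_def by blast
    show "bounded (range w)"
      unfolding w(1) v_def by (intro bounded_range_diff bd w(2))
    show "\<exists>i. w i < e" if "0 < e" for e
      unfolding w(1) v_def by (rule gap[OF w(2,3) that])
    show "(\<lambda>i. c * w i) \<in> V" for c
    proof -
      have "(\<lambda>i. c * w i) = v (Scale c \<phi>) \<sigma>" by (simp add: w(1) v_def fun_eq_iff right_diff_distrib)
      moreover have "wf_fm \<tau> (Scale c \<phi>)" "qf (Scale c \<phi>)" using w by simp_all
      ultimately show ?thesis unfolding V_def by blast
    qed
  next
    have "wf_fm \<tau> (Real 0)" "qf (Real 0 :: ('f, 'r, 'c) fm)" by simp_all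
    then have "v (Real 0) undefined \<in> V" unfolding V_def by blast
    then show "V \<noteq> {}" by blast
  next
    fix w w' assume "w \<in> V" "w' \<in> V"
    then obtain \<phi> \<sigma> \<phi>' \<sigma>' where w: "w = v \<phi> \<sigma>" "wf_fm \<tau> \<phi>" "qf \<phi>"
      and w': "w' = v \<phi>' \<sigma>'" "wf_fm \<tau> \<phi>'" "qf \<phi>'" unfolding V_def by blast
    \<comment> \<open>The two formulas are moved to the even and the odd variables, so that their
      separate assignments merge into the single \<open>?\<rho>\<close>.\<close>
    let ?\<psi> = "Plus (rename_fm (\<lambda>n. 2 * n) \<phi>) (rename_fm (\<lambda>n. 2 * n + 1) \<phi>')"
    let ?\<rho> = "\<lambda>n. if even n then \<sigma> (n div 2) else \<sigma>' (n div 2)"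
    have "(\<lambda>i. w i + w' i) = v ?\<psi> ?\<rho>"
      unfolding w(1) w'(1) v_def fm_val.simps fm_val_rename[OF w(3)] fm_val_rename[OF w'(3)]
      by (simp add: fun_eq_iff)
    moreover have "wf_fm \<tau> ?\<psi>" "qf ?\<psi>"
      using w w' by (simp_all add: wf_fm_rename qf_rename)
    ultimately show "(\<lambda>i. w i + w' i) \<in> V" unfolding V_def by blast
  qed
  then obtain L where L: "mean L" "\<forall>w\<in>V. L w = 0" by blast
  have "L (\<lambda>i. fm_val p M \<phi> (\<lambda>n. P (\<sigma> n) i)) = L (\<lambda>i. fm_val p N \<phi> (\<lambda>n. Q (\<sigma> n) i))"
    if "wf_fm \<tau> \<phi>" "qf \<phi>" for \<phi> :: "('f, 'r, 'c) fm" and \<sigma>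
  proof -
    have "v \<phi> \<sigma> \<in> V" unfolding V_def using that by blast
    then have "L (v \<phi> \<sigma>) = 0" using L(2) by blast
    then show ?thesis unfolding v_def mean_diff[OF L(1) bd[OF that(1)]] by simp
  qed
  then show ?thesis using L(1) by blast
qed

theorem theorem6p3:
  fixes p :: real
    and \<tau> :: "('f, 'r, 'c) signature"
    and M :: "('a, 'f, 'r, 'c) struct"
    and N :: "('b, 'f, 'r, 'c) struct"
  assumes "1 \<le> p"
    and "wf_signature \<tau>"
    and "structure_on p \<tau> M" and "complete_struct M"
    and "structure_on p \<tau> N" and "complete_struct N"
    and "elem_equiv p \<tau> M N"
  shows "\<exists>(I :: ('a, 'b) index set) \<A> \<mu>.
           charge_space I \<A> \<mu> \<and> meanable \<A> M \<and> meanable \<A> N \<and>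
           isomorphic_structs \<tau> (powermean p I \<A> \<mu> M) (powermean p I \<A> \<mu> N)"
proof -
  note M = assms(3) and N = assms(5)
  let ?X = "str_carrier M" and ?Y = "str_carrier N"
  obtain x y where xy: "x \<in> ?X" "y \<in> ?Y"
    using structure_onD(2)[OF M] structure_onD(2)[OF N] by blast
  then have "?X \<times> ?Y \<noteq> {}" by blast
  from projections_exist[OF this] obtain pr :: "('a, 'b) index \<Rightarrow> ('a, 'b) coord \<Rightarrow> 'a \<times> 'b"
    where pr: "range pr = {w. \<forall>t. w t \<in> ?X \<times> ?Y}" ..
  have pr_in: "fst (pr i t) \<in> ?X" "snd (pr i t) \<in> ?Y" for i t
  proof -
    have "pr i t \<in> ?X \<times> ?Y" using pr by blast
    then show "fst (pr i t) \<in> ?X" "snd (pr i t) \<in> ?Y" by auto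
  qed
  define P where "P = left_comp ?X x pr"
  define Q where "Q = right_comp ?Y y pr"
  have eM: "surj (\<lambda>u :: ('a, 'b) base. case u of Inr (Inl a) \<Rightarrow> a | _ \<Rightarrow> x)"
    by (rule surjI[of _ "\<lambda>a. Inr (Inl a)"]) simp
  have eN: "surj (\<lambda>u :: ('a, 'b) base. case u of Inr (Inr b) \<Rightarrow> b | _ \<Rightarrow> y)"
    by (rule surjI[of _ "\<lambda>b. Inr (Inr b)"]) simp
  have P: "range P = meas_maps UNIV (few_sets pr) M"
    unfolding P_def meas_maps_few_sets[OF M eM] by (rule range_left_comp[OF pr_in(1) xy(1)])
  have Q: "range Q = meas_maps UNIV (few_sets pr) N"
    unfolding Q_def meas_maps_few_sets[OF N eN] by (rule range_right_comp[OF pr_in(2) xy(2)])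
  have P_in: "P t i \<in> ?X" and Q_in: "Q t i \<in> ?Y" for t i
    using range_left_comp[of pr ?X x, OF pr_in(1) xy(1)]
      range_right_comp[of pr ?Y y, OF pr_in(2) xy(2)] unfolding P_def Q_def by blast+
  have gap: "\<exists>i. fm_val p M \<phi> (\<lambda>n. P (\<sigma> n) i) - fm_val p N \<phi> (\<lambda>n. Q (\<sigma> n) i) < e"
    if "wf_fm \<tau> \<phi>" "inj_on \<sigma> (free_vars \<phi>)" "0 < e" for \<phi> \<sigma> e
    by (rule fm_val_gap_small[OF M N assms(1,7) P_in Q_in wf_child _ that])
      (unfold P_def Q_def, rule comps_free[OF pr])
  have qf_gap: "\<exists>i. fm_val p M \<phi> (\<lambda>n. P (\<sigma> n) i) - fm_val p N \<phi> (\<lambda>n. Q (\<sigma> n) i) < e"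
    if "wf_fm \<tau> \<phi>" "qf \<phi>" "0 < e" for \<phi> \<sigma> e
    by (rule qf_fm_val_gap_small[OF _ that]) (rule gap)
  have "\<exists>L. mean L \<and> (\<forall>(\<phi> :: ('f, 'r, 'c) fm) \<sigma>. wf_fm \<tau> \<phi> \<longrightarrow> qf \<phi> \<longrightarrow>
      L (\<lambda>i. fm_val p M \<phi> (\<lambda>n. P (\<sigma> n) i)) = L (\<lambda>i. fm_val p N \<phi> (\<lambda>n. Q (\<sigma> n) i)))"
    by (rule balanced_mean_exists[OF M N assms(1) P_in Q_in]) (rule qf_gap)
  then obtain L where L: "mean L" and bal: "\<forall>(\<phi> :: ('f, 'r, 'c) fm) \<sigma>. wf_fm \<tau> \<phi> \<longrightarrow> qf \<phi> \<longrightarrow>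
      L (\<lambda>i. fm_val p M \<phi> (\<lambda>n. P (\<sigma> n) i)) = L (\<lambda>i. fm_val p N \<phi> (\<lambda>n. Q (\<sigma> n) i))"
    by (elim exE conjE)
  have "isomorphic_structs \<tau> (powermean p UNIV (few_sets pr) (mean_charge L) M)
      (powermean p UNIV (few_sets pr) (mean_charge L) N)"
    by (rule isomorphic_powermeans[OF mean_structure_few_sets[OF assms(1,2) M L eM]
          mean_structure_few_sets[OF assms(1,2) N L eN] P Q]) (use bal in blast)
  moreover have "meanable (few_sets pr) M" "meanable (few_sets pr) N"
    by (rule meanable_few_sets[OF M eM], rule meanable_few_sets[OF N eN])
  moreover have "charge_space UNIV (few_sets pr) (mean_charge L)"
    by (rule charge_space_mean_charge[OF L algebra_few_sets])
  ultimately show ?thesis by blast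
qed

end
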